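(* Every finite planar graph that contains no cycle of length $4$, $5$, $6$, $7$, or $8$ is properly $3$-colorable.
   Context: A proper $3$-coloring of a graph is an assignment of one of three colors to each vertex so that adjacent vertices receive different colors. *)

theory Defs
  imports "HOL-Analysis.Analysis"
begin

definition simple_graph :: "'a set \<Rightarrow> 'a set set \<Rightarrow> bool" where
  "simple_graph V E \<longleftrightarrow> (\<forall>e\<in>E. \<exists>u v. e = {u, v} \<and> u \<noteq> v \<and> u \<in> V \<and> v \<in> V)"

definition planar :: "'a set \<Rightarrow> 'a set set \<Rightarrow> bool" where
  "planar V E \<longleftrightarrow>
     (\<exists>(p :: 'a \<Rightarrow> complex) (\<gamma> :: 'a set \<Rightarrow> real \<Rightarrow> complex).
        inj_on p V \<and>
        (\<forall>e\<in>E. arc (\<gamma> e) \<and>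
                 {pathstart (\<gamma> e), pathfinish (\<gamma> e)} = p ` e \<and>
                 path_image (\<gamma> e) \<inter> p ` V = p ` e) \<and>
        (\<forall>e\<in>E. \<forall>e'\<in>E. e \<noteq> e' \<longrightarrow>
                 path_image (\<gamma> e) \<inter> path_image (\<gamma> e') \<subseteq> p ` (e \<inter> e')))"

definition has_cycle_of_length :: "'a set \<Rightarrow> 'a set set \<Rightarrow> nat \<Rightarrow> bool" where
  "has_cycle_of_length V E k \<longleftrightarrow>
     (\<exists>vs. length vs = k \<and> distinct vs \<and> set vs \<subseteq> V \<and>
           (\<forall>i<k. {vs ! i, vs ! ((i + 1) mod k)} \<in> E))"

definition proper_3_colorable :: "'a set \<Rightarrow> 'a set set \<Rightarrow> bool" where
  "proper_3_colorable V E \<longleftrightarrow>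
     (\<exists>c :: 'a \<Rightarrow> nat. (\<forall>v\<in>V. c v < 3) \<and>
        (\<forall>u\<in>V. \<forall>v\<in>V. {u, v} \<in> E \<longrightarrow> c u \<noteq> c v))"

end

theory Submission
  imports Defs "HOL-Complex_Analysis.Winding_Numbers"
begin

text \<open>A graph that is not 3-colorable contains a 4-critical subgraph with vertex set \<open>W\<close> and edge set
  \<open>F\<close>. By the theorem of Kostochka and Yancey, such a graph satisfies \<open>5|W| - 3|F| \<le> 2\<close>. If it is
  plane without cycles of length 4 to 8, then every bounded face is a triangle or has length at least 9,
  and triangles are edge-disjoint, so a vertex of degree \<open>d \<ge> 3\<close> lies on at most \<open>d - 2\<close> of them;
  Euler's formula then gives \<open>5|W| - 3|F| \<ge> 9\<close>.

  Euler's formula is obtained by building the (2-connected) critical graph from a cycle by adding ears: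
  an ear lies in one face, and the Jordan curve theorem for theta curves splits that face in two.\<close>

section \<open>The potential of critical graphs\<close>

text \<open>The two estimates meet exactly at face length 9. If every bounded face other than a
  triangle has length at least l, the count yields l|F| + 3l <= (l + 6)|W|, and the slope (l + 6)/l
  comes down to the 5/3 of the Kostochka-Yancey bound precisely at l = 9; hence the excluded lengths
  4 to 8.

  That bound is proved here by the potential method. In a counterexample with fewest vertices, every
  proper subset with at least two vertices has potential at least 6. This slack pays for adding an
  edge (worth 3) or for identifying two vertices (worth 5), so there are colorings of proper
  subgraphs with prescribed behaviour on a pair of vertices. Such colorings restrict the vertices of
  degree 3 so much that a degree count gives 5|V| <= 3|E|.

  Criticality also serves the topology: a critical graph has no cut vertex, so every face is one
  side of a closed curve traced by a vertex cycle. The ear induction therefore never meets a face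
  with a more complicated boundary.\<close>

definition edges_in :: "'a set set \<Rightarrow> 'a set \<Rightarrow> 'a set set" where
  "edges_in E R = {e \<in> E. e \<subseteq> R}"

text \<open>The complete graph on four vertices has potential 20 - 18 = 2, so the bound in
  \<open>critical_potential\<close> is attained.\<close>

definition potential :: "'a set set \<Rightarrow> 'a set \<Rightarrow> int" where
  "potential E R = 5 * int (card R) - 3 * int (card (edges_in E R))"

text \<open>Minimality ranges over all subgraphs, so it covers deletion of vertices and of single
  edges at once.\<close>

definition critical :: "'a set \<Rightarrow> 'a set set \<Rightarrow> bool" where
  "critical V E \<longleftrightarrow> finite V \<and> simple_graph V E \<and> \<not> proper_3_colorable V E \<and>
     (\<forall>R F. R \<subseteq> V \<longrightarrow> F \<subseteq> edges_in E R \<longrightarrow> (R, F) \<noteq> (V, E) \<longrightarrow> proper_3_colorable R F)"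

lemma simple_graphD:
  assumes "simple_graph V E" "e \<in> E"
  shows "e \<subseteq> V" "card e = 2"
  using assms by (auto simp: simple_graph_def)

lemma simple_graph_iff: "simple_graph V E \<longleftrightarrow> (\<forall>e\<in>E. e \<subseteq> V \<and> card e = 2)"
  unfolding simple_graph_def card_2_iff by fastforce

lemma simple_graph_finite:
  assumes "simple_graph V E" "finite V"
  shows "finite E"
  by (rule finite_subset[of _ "Pow V"]) (use simple_graphD(1)[OF assms(1)] assms(2) in auto)

lemma simple_graph_mono: "simple_graph V E \<Longrightarrow> F \<subseteq> edges_in E R \<Longrightarrow> simple_graph R F"
  unfolding simple_graph_iff edges_in_def by auto

lemma edges_in_self: "simple_graph V E \<Longrightarrow> edges_in E V = E"
  unfolding simple_graph_iff edges_in_def by auto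

lemma finite_edges_in: "finite R \<Longrightarrow> finite (edges_in E R)"
  by (rule finite_subset[of _ "Pow R"]) (auto simp: edges_in_def)

lemma colorable_mono:
  assumes "proper_3_colorable V E" "R \<subseteq> V" "F \<subseteq> E"
  shows "proper_3_colorable R F"
proof -
  obtain c :: "'a \<Rightarrow> nat" where "\<forall>v\<in>V. c v < 3" "\<forall>u\<in>V. \<forall>v\<in>V. {u, v} \<in> E \<longrightarrow> c u \<noteq> c v"
    using assms(1) unfolding proper_3_colorable_def by blast
  then show ?thesis
    unfolding proper_3_colorable_def using assms(2,3) by (intro exI[of _ c]) (simp add: subset_iff)
qed

lemma potential_edge_mono:
  assumes "finite R" "F \<subseteq> E"
  shows "potential E R \<le> potential F R"
proof -
  have "card (edges_in F R) \<le> card (edges_in E R)"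
    using assms by (intro card_mono finite_edges_in) (auto simp: edges_in_def)
  then show ?thesis by (simp add: potential_def)
qed

lemma potential_ge:
  assumes "simple_graph V E" "finite X"
  shows "potential E X \<ge> 5 * int (card X) - 3 * int (card X choose 2)"
proof -
  have "edges_in E X \<subseteq> {e. e \<subseteq> X \<and> card e = 2}"
    using assms by (auto simp: edges_in_def simple_graph_iff)
  then have "card (edges_in E X) \<le> card {e. e \<subseteq> X \<and> card e = 2}"
    by (rule card_mono[rotated]) (rule finite_subset[of _ "Pow X"], use assms(2) in auto)
  then have "card (edges_in E X) \<le> card X choose 2"
    using n_subsets[OF assms(2), of 2] by simp
  then show ?thesis by (simp add: potential_def)
qed

text \<open>These are the sizes of what remains of a set after its color classes are collapsed to at
  most three vertices.\<close>

lemma potential_small: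
  assumes "simple_graph V E" "finite X"
  shows "card X = 1 \<Longrightarrow> potential E X \<ge> 5" "card X = 2 \<Longrightarrow> potential E X \<ge> 7"
    "card X = 3 \<Longrightarrow> potential E X \<ge> 6"
  using potential_ge[OF assms] by (simp_all add: choose_two)

lemma potential_insert_edge:
  assumes "finite W"
  shows "potential E W \<le> potential (insert e E) W + 3"
proof -
  have "edges_in (insert e E) W \<subseteq> insert e (edges_in E W)" by (auto simp: edges_in_def)
  then have "card (edges_in (insert e E) W) \<le> Suc (card (edges_in E W))"
    using card_mono[of "insert e (edges_in E W)" "edges_in (insert e E) W"] finite_edges_in[OF assms, of E]
    by (simp add: card_insert_if split: if_splits)
  then show ?thesis by (simp add: potential_def)
qed

lemma exists_critical:
  assumes "finite V" "simple_graph V E" "\<not> proper_3_colorable V E"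
  obtains W F where "W \<subseteq> V" "F \<subseteq> edges_in E W" "critical W F"
proof -
  define P where "P = (\<lambda>(W, F). W \<subseteq> V \<and> F \<subseteq> edges_in E W \<and> \<not> proper_3_colorable W F)"
  have "P (V, E)" using assms edges_in_self by (auto simp: P_def)
  then obtain x where x: "P x" "\<And>y. P y \<Longrightarrow> card (fst x) + card (snd x) \<le> card (fst y) + card (snd y)"
    using ex_has_least_nat[of P "(V,E)" "\<lambda>x. card (fst x) + card (snd x)"] by blast
  obtain W F where xWF: "x = (W, F)" by fastforce
  have WF: "W \<subseteq> V" "F \<subseteq> edges_in E W" "\<not> proper_3_colorable W F" using x(1) by (auto simp: P_def xWF)
  have finW: "finite W" using WF(1) assms(1) finite_subset by blast
  have finF: "finite F" using WF(2) finite_edges_in[OF finW] finite_subset by blast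
  have "critical W F"
    unfolding critical_def
  proof (intro conjI allI impI)
    show "simple_graph W F" using simple_graph_mono assms(2) WF(2) .
    fix R D assume RD: "R \<subseteq> W" "D \<subseteq> edges_in F R" "(R, D) \<noteq> (W, F)"
    show "proper_3_colorable R D"
    proof (rule ccontr)
      assume "\<not> proper_3_colorable R D"
      moreover have DF: "D \<subseteq> F" using RD(2) by (auto simp: edges_in_def)
      moreover have "D \<subseteq> edges_in E R" using RD(2) WF(2) by (auto simp: edges_in_def)
      ultimately have "P (R, D)" using RD WF(1) by (auto simp: P_def)
      then have "card W + card F \<le> card R + card D" using x(2)[of "(R,D)"] xWF by simp
      moreover have "card R \<le> card W" "card D \<le> card F"
        using RD(1) DF finW finF card_mono by blast+
      ultimately have "card R = card W" "card D = card F" by auto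
      then have "R = W" "D = F" using RD(1) DF finW finF card_subset_eq by blast+
      then show False using RD(3) by simp
    qed
  qed (use finW WF in auto)
  then show ?thesis using that WF by blast
qed

lemma critical_sub_colorable:
  assumes "critical V E" "R \<subset> V"
  shows "proper_3_colorable R (edges_in E R)"
proof -
  have "(R, edges_in E R) \<noteq> (V, E)" "R \<subseteq> V" using assms(2) by auto
  then show ?thesis using assms(1) unfolding critical_def by simp
qed

lemma critical_noncolorable_eq:
  assumes "critical V E" "W \<subseteq> V" "\<not> proper_3_colorable W (edges_in E W)"
  shows "W = V"
  using critical_sub_colorable[OF assms(1), of W] assms(2,3) by auto

text \<open>\<open>IH\<close> speaks of arbitrary smaller graphs that are not 3-colorable, because
  it is applied to quotients and to graphs with an added edge, which need not be critical. It only
  covers graphs on the type of \<open>V\<close>, so quotients must be built from vertices already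
  present.\<close>

locale minimal_counterexample =
  fixes V :: "'a set" and E :: "'a set set"
  assumes crit: "critical V E"
    and IH: "\<And>(V' :: 'a set) E'. finite V' \<Longrightarrow> card V' < card V \<Longrightarrow> simple_graph V' E' \<Longrightarrow>
      \<not> proper_3_colorable V' E' \<Longrightarrow>
      \<exists>W\<subseteq>V'. \<not> proper_3_colorable W (edges_in E' W) \<and> potential E' W \<le> 2"
    and pot: "potential E V \<ge> 3"
begin

lemma finV: "finite V" and sg: "simple_graph V E" and noncol: "\<not> proper_3_colorable V E"
  using crit by (auto simp: critical_def)

lemma finE: "finite E" using simple_graph_finite[OF sg finV] .

text \<open>The set \<open>R\<close> is collapsed to one vertex per color class of \<open>\<phi>\<close>. The quotient is still not
  3-colorable, so it has a set of potential at most 2; \<open>W'\<close> is the part of that set outside \<open>R\<close> and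
  \<open>I\<close> the set of color classes it contains. Edges from \<open>W'\<close> to the other classes are not
  counted in the quotient and are a bonus.\<close>

lemma collapse:
  assumes R: "R \<subset> V" "card R \<ge> 4"
    and phi: "\<And>v. v \<in> R \<Longrightarrow> \<phi> v < (3::nat)" "\<And>u v. u \<in> R \<Longrightarrow> v \<in> R \<Longrightarrow> {u,v} \<in> E \<Longrightarrow> \<phi> u \<noteq> \<phi> v"
  obtains W' I where "W' \<subseteq> V - R" "I \<subseteq> {..<3}" "I \<noteq> {}"
    "potential E (R \<union> W') + 3 * int (card {e\<in>E. \<exists>u\<in>R. \<exists>w\<in>W'. e = {u,w} \<and> \<phi> u \<notin> I}) \<le> potential E R - 3"
    "card I \<noteq> 1 \<Longrightarrow> potential E (R \<union> W') \<le> potential E R - 4"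
proof -
  have finR: "finite R" using R(1) finV finite_subset by blast
  \<comment> \<open>Three vertices of \<open>R\<close> itself stand for the color classes, which
    keeps the quotient on the same type; \<open>card R \<ge> 4\<close> makes it strictly smaller.
    The vertex \<open>r i\<close> stands for color \<open>i\<close> whatever its own color
    is.\<close>
  have "3 \<le> card R" using R(2) by simp
  then obtain T where T: "T \<subseteq> R" "card T = 3" by (rule obtain_subset_with_card_n)
  have finT: "finite T" using T(1) finR finite_subset by blast
  obtain r where "bij_betw r {0..<3::nat} T" using ex_bij_betw_nat_finite[OF finT] T(2) by auto
  then have r: "inj_on r {..<3}" "r ` {..<3} = T" by (auto simp: bij_betw_def lessThan_atLeast0)
  define f where "f v = (if v \<in> R then r (\<phi> v) else v)" for v
  define H where "H = (`) f ` E"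
  have fR: "f v \<in> T" if "v \<in> R" for v using that phi(1) r(2) by (auto simp: f_def)
  have fV: "f ` V \<subseteq> (V - R) \<union> T" using fR by (auto simp: f_def)
  have Eu: "\<exists>u v. e = {u,v} \<and> u \<noteq> v \<and> u \<in> V \<and> v \<in> V" if "e \<in> E" for e
    using that sg by (auto simp: simple_graph_def)
  have fne: "f u \<noteq> f v" if "{u,v} \<in> E" "u \<noteq> v" for u v
  proof (cases "u \<in> R \<and> v \<in> R")
    case True
    then have "\<phi> u \<noteq> \<phi> v" "\<phi> u < 3" "\<phi> v < 3" using phi that by auto
    then show ?thesis using True r(1) by (auto simp: f_def inj_on_def)
  next
    case False then show ?thesis using fR T(1) that by (auto simp: f_def)
  qed
  have sgH: "simple_graph (f ` V) H"
    unfolding simple_graph_def H_def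
  proof
    fix h assume "h \<in> (`) f ` E"
    then obtain e where e: "e \<in> E" "h = f ` e" by auto
    then obtain u v where uv: "e = {u,v}" "u \<noteq> v" "u \<in> V" "v \<in> V" using Eu by blast
    show "\<exists>u v. h = {u, v} \<and> u \<noteq> v \<and> u \<in> f ` V \<and> v \<in> f ` V"
      using fne[of u v] e uv by auto
  qed
  have "\<not> proper_3_colorable (f ` V) H"
  proof
    assume "proper_3_colorable (f ` V) H"
    then obtain c :: "'a \<Rightarrow> nat" where c: "\<forall>v\<in>f ` V. c v < 3"
      "\<forall>u\<in>f`V. \<forall>v\<in>f`V. {u, v} \<in> H \<longrightarrow> c u \<noteq> c v" unfolding proper_3_colorable_def by blast
    have "\<forall>u\<in>V. \<forall>v\<in>V. {u, v} \<in> E \<longrightarrow> c (f u) \<noteq> c (f v)"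
      using c(2) unfolding H_def by (metis (no_types, lifting) image_eqI image_insert image_empty)
    then have "proper_3_colorable V E" using c(1) unfolding proper_3_colorable_def by (intro exI[of _ "c \<circ> f"]) auto
    then show False using noncol by simp
  qed
  moreover have "card (f ` V) < card V"
  proof -
    have "card (f ` V) \<le> card ((V - R) \<union> T)" using fV finV finT by (intro card_mono) auto
    also have "\<dots> \<le> card (V - R) + 3" using card_Un_le[of "V-R" T] T(2) by simp
    also have "card (V - R) = card V - card R" using finR R(1) by (intro card_Diff_subset) auto
    finally show ?thesis using R(2) card_mono[OF finV, of R] R(1) by auto
  qed
  ultimately obtain W where W: "W \<subseteq> f ` V" "\<not> proper_3_colorable W (edges_in H W)" "potential H W \<le> 2"
    using IH[of "f ` V" H] finV sgH by auto
  define X where "X = W \<inter> T"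
  define W' where "W' = W - T"
  define I where "I = {i. i < 3 \<and> r i \<in> W}"
  have finW: "finite W" using W(1) finV finite_subset by blast
  have W'sub: "W' \<subseteq> V - R" using W(1) fV by (auto simp: W'_def)
  have XI: "X = r ` I" using r(2) by (auto simp: X_def I_def)
  have cardX: "card X = card I" unfolding XI by (rule card_image) (use r(1) in \<open>auto simp: I_def inj_on_def\<close>)
  \<comment> \<open>Otherwise the bad set avoids \<open>R\<close> and already induces a
    non-3-colorable proper subgraph of the critical graph.\<close>
  have Ine: "I \<noteq> {}"
  proof
    assume "I = {}"
    then have WW: "W \<subseteq> V - R" using XI W'sub by (auto simp: X_def W'_def)
    have "edges_in H W \<subseteq> edges_in E W"
    proof
      fix h assume "h \<in> edges_in H W"
      then obtain e where e: "e \<in> E" "h = f ` e" "f ` e \<subseteq> W" by (auto simp: edges_in_def H_def)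
      have "v \<notin> R" if "v \<in> e" for v using fR[of v] that e(3) WW T(1) by auto
      then have "f ` e = e" by (auto simp: f_def image_iff)
      then show "h \<in> edges_in E W" using e by (auto simp: edges_in_def)
    qed
    then have "\<not> proper_3_colorable W (edges_in E W)" using W(2) colorable_mono by blast
    then have "W = V" using critical_noncolorable_eq[OF crit] WW by blast
    then have "R = {}" using WW R(1) by blast
    then show False using R(2) by simp
  qed
  \<comment> \<open>The edges of \<open>H\<close> inside \<open>W\<close> split into those inside
    \<open>X\<close> and \<open>D\<close>, and each edge of \<open>D\<close> is the image of one in
    \<open>B\<close>. The edges inside \<open>R\<close>, \<open>B\<close> and the bonus
    \<open>S\<close> are disjoint: an edge of \<open>S\<close> is sent to a class vertex outside
    \<open>W\<close>, an edge of \<open>B\<close> is not.\<close>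
  define B where "B = {e\<in>E. e \<subseteq> R \<union> W' \<and> \<not> e \<subseteq> R \<and> f ` e \<subseteq> W}"
  define S where "S = {e\<in>E. \<exists>u\<in>R. \<exists>w\<in>W'. e = {u,w} \<and> \<phi> u \<notin> I}"
  define D where "D = {h\<in>H. h \<subseteq> W \<and> \<not> h \<subseteq> X}"
  have finB: "finite B" and finS: "finite S" unfolding B_def S_def using finE by auto
  have "D \<subseteq> (`) f ` B"
  proof
    fix h assume "h \<in> D"
    then obtain e where e: "e \<in> E" "h = f ` e" "f ` e \<subseteq> W" "\<not> f ` e \<subseteq> X" by (auto simp: D_def H_def)
    have "v \<in> R \<union> W'" if "v \<in> e" for v
    proof (cases "v \<in> R")
      case False
      then have "f v = v" by (simp add: f_def)
      then show ?thesis using e(3) that False T(1) by (auto simp: W'_def)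
    qed simp
    moreover have "\<not> e \<subseteq> R" using e(3,4) fR by (auto simp: X_def)
    ultimately show "h \<in> (`) f ` B" using e by (auto simp: B_def)
  qed
  then have DB: "card D \<le> card B" using finB by (meson card_image_le card_mono finite_imageI order_trans)
  have wHW: "card (edges_in H W) = card D + card (edges_in H X)"
  proof -
    have "edges_in H W = D \<union> edges_in H X" by (auto simp: edges_in_def D_def X_def)
    moreover have "D \<inter> edges_in H X = {}" by (auto simp: edges_in_def D_def)
    moreover have "finite (edges_in H W)" using finite_edges_in[OF finW] .
    ultimately show ?thesis by (metis card_Un_disjoint finite_Un)
  qed
  have wE: "card (edges_in E R) + card B + card S \<le> card (edges_in E (R \<union> W'))"
  proof -
    have d1: "edges_in E R \<inter> B = {}" by (auto simp: edges_in_def B_def)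
    have d2: "(edges_in E R \<union> B) \<inter> S = {}"
    proof -
      have False if e: "e \<in> edges_in E R \<union> B" "e \<in> S" for e
      proof -
        obtain u w where uw: "u \<in> R" "w \<in> W'" "e = {u,w}" "\<phi> u \<notin> I" using e(2) by (auto simp: S_def)
        have "e \<in> B" using e(1) uw W'sub by (auto simp: edges_in_def)
        then have "f u \<in> W" using uw by (auto simp: B_def)
        then show False using uw phi(1) by (auto simp: f_def I_def)
      qed
      then show ?thesis by blast
    qed
    have "edges_in E R \<union> B \<union> S \<subseteq> edges_in E (R \<union> W')" by (auto simp: edges_in_def B_def S_def)
    then have "card (edges_in E R \<union> B \<union> S) \<le> card (edges_in E (R \<union> W'))"
      using finR finW by (intro card_mono finite_edges_in) (auto simp: W'_def)
    then show ?thesis using d1 d2 finB finS finite_edges_in[OF finR] by (simp add: card_Un_disjoint)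
  qed
  have cRW: "card (R \<union> W') = card R + card W'"
    using W'sub finR finW by (intro card_Un_disjoint) (auto simp: W'_def)
  have cW: "card W = card W' + card I"
  proof -
    have "W = W' \<union> X" "W' \<inter> X = {}" by (auto simp: W'_def X_def)
    moreover have "finite W'" "finite X" using finW by (auto simp: W'_def X_def)
    ultimately show ?thesis using card_Un_disjoint[of W' X] cardX by simp
  qed
  \<comment> \<open>Trading the class vertices \<open>X\<close> for all of \<open>R\<close> changes
    the potential by at most \<open>potential E R - potential H X\<close>, and each edge of
    \<open>S\<close> takes off another 3.\<close>
  have main: "potential E (R \<union> W') + 3 * int (card S) \<le> potential E R + 2 - potential H X"
    using W(3) DB wHW wE cRW cW cardX unfolding potential_def by simp
  have "card I \<le> 3" using card_mono[of "{..<3}" I] by (auto simp: I_def)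
  moreover have "card I \<noteq> 0" using Ine by (simp add: I_def)
  ultimately have cI: "card X = 1 \<or> card X = 2 \<or> card X = 3" using cardX by linarith
  have pX: "potential H X \<ge> 5" "card I \<noteq> 1 \<Longrightarrow> potential H X \<ge> 6"
    using cI cardX potential_small[OF sgH, of X] finW by (auto simp: X_def)
  show ?thesis
  proof (rule that[OF W'sub _ Ine])
    show "I \<subseteq> {..<3}" by (auto simp: I_def)
    show "potential E (R \<union> W') + 3 * int (card {e\<in>E. \<exists>u\<in>R. \<exists>w\<in>W'. e = {u,w} \<and> \<phi> u \<notin> I}) \<le> potential E R - 3"
      using main pX(1) unfolding S_def[symmetric] by linarith
    show "potential E (R \<union> W') \<le> potential E R - 4" if "card I \<noteq> 1" using main pX(2)[OF that] by linarith
  qed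
qed

end

section \<open>Colorings, separations and minimum degree of critical graphs\<close>

definition coloring :: "'a set \<Rightarrow> 'a set set \<Rightarrow> ('a \<Rightarrow> nat) \<Rightarrow> bool" where
  "coloring U E c \<longleftrightarrow> (\<forall>v\<in>U. c v < 3) \<and> (\<forall>u\<in>U. \<forall>v\<in>U. {u, v} \<in> E \<longrightarrow> c u \<noteq> c v)"

definition nbrs :: "'a set set \<Rightarrow> 'a \<Rightarrow> 'a set" where
  "nbrs E v = {w. {v, w} \<in> E}"

lemma colorable_iff: "proper_3_colorable V E \<longleftrightarrow> (\<exists>c. coloring V E c)"
  by (simp add: proper_3_colorable_def coloring_def)

lemma coloring_edges_in: "coloring U (edges_in E U) c \<longleftrightarrow> coloring U E c"
  by (auto simp: coloring_def edges_in_def)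

lemma critical_coloring:
  assumes "critical V E" "R \<subset> V"
  obtains c where "coloring R E c"
  using critical_sub_colorable[OF assms] by (auto simp: colorable_iff coloring_edges_in)

lemma nbrs_sym: "w \<in> nbrs E v \<longleftrightarrow> v \<in> nbrs E w"
  by (simp add: nbrs_def insert_commute)

lemma nbrs_subset: "simple_graph V E \<Longrightarrow> nbrs E v \<subseteq> V - {v}"
  by (force simp: nbrs_def simple_graph_iff)

text \<open>This is 2-connectedness. Both sides of a separation are colorable by criticality, and
  swapping two colors on \<open>B\<close> makes the colorings agree at the one shared
  vertex.\<close>

lemma critical_no_separation:
  assumes crit: "critical V E" and AB: "A \<union> B = V" "A \<noteq> V" "B \<noteq> V" "card (A \<inter> B) \<le> 1"
  shows "\<exists>e\<in>E. \<not> e \<subseteq> A \<and> \<not> e \<subseteq> B"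
proof (rule ccontr)
  assume "\<not> ?thesis"
  then have sep: "\<And>e. e \<in> E \<Longrightarrow> e \<subseteq> A \<or> e \<subseteq> B" by blast
  have finV: "finite V" using crit by (simp add: critical_def)
  obtain cA where cA: "coloring A E cA" using critical_coloring[OF crit, of A] AB by blast
  obtain cB where cB: "coloring B E cB" using critical_coloring[OF crit, of B] AB by blast
  have finAB: "finite (A \<inter> B)" using AB(1) finV by (metis finite_Int finite_Un)
  obtain cB' where cB': "coloring B E cB'" "\<And>v. v \<in> A \<inter> B \<Longrightarrow> cB' v = cA v"
  proof (cases "A \<inter> B = {}")
    case True then show ?thesis using that[OF cB] by blast
  next
    case False
    then have "card (A \<inter> B) = 1" using AB(4) finAB by (simp add: le_Suc_eq)
    then obtain h where h: "A \<inter> B = {h}" using card_1_singletonE by blast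
    define s where "s i = (if i = cB h then cA h else if i = cA h then cB h else i)" for i
    have inj: "s i = s j \<Longrightarrow> i = j" for i j by (auto simp: s_def split: if_splits)
    have lt: "s i < 3" if "i < 3" for i
      using that cA cB h by (auto simp: s_def coloring_def)
    have "coloring B E (\<lambda>v. s (cB v))" using cB inj lt unfolding coloring_def by blast
    moreover have "s (cB h) = cA h" by (simp add: s_def)
    ultimately show ?thesis using that h by auto
  qed
  define c where "c v = (if v \<in> A then cA v else cB' v)" for v
  have cBc: "c v = cB' v" if "v \<in> B" for v using that cB'(2) by (auto simp: c_def)
  have "coloring V E c"
    unfolding coloring_def
  proof (intro conjI ballI impI)
    fix v assume "v \<in> V" then show "c v < 3"
      using cA cB'(1) AB(1) by (auto simp: c_def coloring_def)
  next
    fix u v assume "{u, v} \<in> E"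
    then consider "u \<in> A" "v \<in> A" | "u \<in> B" "v \<in> B" using sep[of "{u,v}"] by auto
    then show "c u \<noteq> c v"
    proof cases
      case 1 then show ?thesis using cA \<open>{u,v} \<in> E\<close> by (auto simp: c_def coloring_def)
    next
      case 2 then show ?thesis using cB'(1) \<open>{u,v} \<in> E\<close> cBc by (auto simp: coloring_def)
    qed
  qed
  then show False using crit by (auto simp: critical_def colorable_iff)
qed

lemma free_color:
  assumes "finite A" "card A \<le> 2"
  obtains k where "k < (3::nat)" "k \<notin> A"
proof -
  have "\<not> {..<3} \<subseteq> A" using assms card_mono[of A "{..<3}"] by auto
  then show ?thesis using that by blast
qed

lemma critical_min_degree:
  assumes crit: "critical V E" and v: "v \<in> V"
  shows "card (nbrs E v) \<ge> 3"
proof (rule ccontr)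
  assume deg: "\<not> card (nbrs E v) \<ge> 3"
  have sg: "simple_graph V E" and finV: "finite V" using crit by (auto simp: critical_def)
  obtain c where c: "coloring (V - {v}) E c" using critical_coloring[OF crit, of "V - {v}"] v by blast
  have fin: "finite (nbrs E v)" using nbrs_subset[OF sg] finV by (meson finite_Diff finite_subset)
  have "card (c ` nbrs E v) \<le> 2" using card_image_le[OF fin, of c] deg by simp
  then obtain k where k: "k < 3" "k \<notin> c ` nbrs E v" using free_color fin by blast
  have nv: "w \<noteq> v" if "{v,w} \<in> E" for w using nbrs_subset[OF sg, of v] that by (auto simp: nbrs_def)
  have "coloring V E (c(v := k))"
    using c k nv by (auto simp: coloring_def nbrs_def insert_commute)
  then show False using crit by (auto simp: critical_def colorable_iff)
qed

section \<open>Potentials of proper subsets in a minimal counterexample\<close>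

context minimal_counterexample
begin

lemma extend2:
  assumes c: "coloring (V - {x,y}) E c"
    and i: "i < 3" "i \<notin> c ` (nbrs E x - {y})" and j: "j < 3" "j \<notin> c ` (nbrs E y - {x})"
    and ne: "i \<noteq> j" "x \<noteq> y"
  shows False
proof -
  have nl: "{v,w} \<in> E \<Longrightarrow> v \<noteq> w" for v w using nbrs_subset[OF sg, of v] by (auto simp: nbrs_def)
  have "coloring V E (c(x := i, y := j))"
    unfolding coloring_def
  proof (intro conjI ballI impI)
    fix v assume "v \<in> V" then show "(c(x := i, y := j)) v < 3" using c i j by (auto simp: coloring_def)
  next
    fix u v assume uv: "u \<in> V" "v \<in> V" "{u,v} \<in> E"
    then have vu: "{v,u} \<in> E" "u \<noteq> v" using nl by (auto simp: insert_commute)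
    consider "u = x" "v = y" | "u = y" "v = x" | "u = x" "v \<notin> {x,y}" | "u = y" "v \<notin> {x,y}"
      | "v = x" "u \<notin> {x,y}" | "v = y" "u \<notin> {x,y}" | "u \<notin> {x,y}" "v \<notin> {x,y}" using vu by blast
    then show "(c(x := i, y := j)) u \<noteq> (c(x := i, y := j)) v"
    proof cases
      case 3 then show ?thesis using i(2) uv ne by (auto simp: nbrs_def)
    next
      case 4 then show ?thesis using j(2) uv ne by (auto simp: nbrs_def)
    next
      case 5 then show ?thesis using i(2) vu ne by (auto simp: nbrs_def)
    next
      case 6 then show ?thesis using j(2) vu ne by (auto simp: nbrs_def)
    next
      case 7 then show ?thesis using c uv by (auto simp: coloring_def)
    qed (use ne in auto)
  qed
  then show False using noncol by (auto simp: colorable_iff)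
qed

text \<open>Let \<open>R0\<close> have least potential \<open>m\<close> among these sets. If
  \<open>m \<le> 5\<close>, collapsing \<open>R0\<close> gives a superset of potential at most
  \<open>m - 3\<close>. Such a set contradicts minimality if it is proper, and \<open>pot\<close> if
  it is all of \<open>V\<close>.\<close>

lemma potential_ge_6:
  assumes "R \<subset> V" "card R \<ge> 2"
  shows "potential E R \<ge> 6"
proof -
  define P where "P = (\<lambda>R. R \<subset> V \<and> card R \<ge> 2)"
  have finP: "finite {potential E R | R. P R}"
  proof -
    have "{potential E R | R. P R} \<subseteq> potential E ` Pow V" by (auto simp: P_def)
    then show ?thesis by (rule finite_subset) (simp add: finV)
  qed
  define m where "m = Min {potential E R | R. P R}"
  have "m \<in> {potential E R | R. P R}" unfolding m_def using assms by (intro Min_in finP) (auto simp: P_def)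
  then obtain R0 where R0: "P R0" "potential E R0 = m" by auto
  have min: "m \<le> potential E R" if "P R" for R unfolding m_def using that by (intro Min_le finP) auto
  have "m \<ge> 6"
  proof (rule ccontr)
    assume m: "\<not> m \<ge> 6"
    have finR0: "finite R0" using R0 finV by (auto simp: P_def intro: finite_subset)
    have "card R0 \<noteq> 2" "card R0 \<noteq> 3" using potential_small[OF sg finR0] R0(2) m by auto
    then have c4: "card R0 \<ge> 4" using R0(1) by (auto simp: P_def)
    obtain \<phi> where phi: "coloring R0 E \<phi>" using critical_coloring[OF crit] R0(1) by (auto simp: P_def)
    obtain W' I where W': "W' \<subseteq> V - R0"
      "potential E (R0 \<union> W') + 3 * int (card {e\<in>E. \<exists>u\<in>R0. \<exists>w\<in>W'. e = {u,w} \<and> \<phi> u \<notin> I}) \<le> potential E R0 - 3"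
    proof (rule collapse[of R0 \<phi>])
      show "R0 \<subset> V" using R0(1) by (simp add: P_def)
      show "\<And>v. v \<in> R0 \<Longrightarrow> \<phi> v < 3" "\<And>u v. u \<in> R0 \<Longrightarrow> v \<in> R0 \<Longrightarrow> {u, v} \<in> E \<Longrightarrow> \<phi> u \<noteq> \<phi> v"
        using phi by (auto simp: coloring_def)
    qed (use c4 in blast)+
    have less: "potential E (R0 \<union> W') \<le> m - 3" using W'(2) R0(2) by linarith
    show False
    proof (cases "R0 \<union> W' = V")
      case True then show ?thesis using less m pot by simp
    next
      case False
      have "card R0 \<le> card (R0 \<union> W')" using W'(1) finV R0(1) by (intro card_mono) (auto simp: P_def intro: finite_subset)
      then have "P (R0 \<union> W')" using False W'(1) R0(1) by (auto simp: P_def)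
      then show ?thesis using min[of "R0 \<union> W'"] less by simp
    qed
  qed
  then show ?thesis using min[of R] assms by (simp add: P_def)
qed

lemma card_ge_2_of_potential:
  assumes "simple_graph U F" "finite W" "W \<noteq> {}" "potential F W \<le> 2"
  shows "card W \<ge> 2"
proof -
  have "card W \<noteq> 0" using assms by simp
  moreover have "card W \<noteq> 1" using potential_small(1)[OF assms(1,2)] assms(4) by auto
  ultimately show ?thesis by linarith
qed

lemma noncolorable_nonempty: "\<not> proper_3_colorable W F \<Longrightarrow> W \<noteq> {}"
  by (auto simp: proper_3_colorable_def)

text \<open>Add the edge \<open>{a,b}\<close>. If this destroyed colorability, \<open>IH\<close>
  would give a set of potential at most 2, hence at most 5 without the new edge, against
  \<open>potential_ge_6\<close>.\<close>

lemma ex_coloring_distinct: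
  assumes U: "U \<subset> V" and ab: "a \<in> U" "b \<in> U" "a \<noteq> b"
  obtains c where "coloring U E c" "c a \<noteq> c b"
proof -
  define F where "F = insert {a,b} (edges_in E U)"
  have finU: "finite U" using U finV finite_subset by blast
  have sgF: "simple_graph U F" using ab sg by (auto simp: F_def simple_graph_iff edges_in_def)
  have "proper_3_colorable U F"
  proof (rule ccontr)
    assume "\<not> proper_3_colorable U F"
    then obtain W where W: "W \<subseteq> U" "\<not> proper_3_colorable W (edges_in F W)" "potential F W \<le> 2"
      using IH[OF finU _ sgF] psubset_card_mono[OF finV U] by blast
    have finW: "finite W" using W(1) finU finite_subset by blast
    have "card W \<ge> 2" using card_ge_2_of_potential[OF sgF finW] noncolorable_nonempty W by blast
    then have "potential E W \<ge> 6" using potential_ge_6 W(1) U by blast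
    moreover have "potential E W \<le> potential (edges_in E U) W"
      by (rule potential_edge_mono[OF finW]) (auto simp: edges_in_def)
    moreover have "potential (edges_in E U) W \<le> 5"
      using potential_insert_edge[OF finW, of "edges_in E U" "{a,b}"] W(3) unfolding F_def by linarith
    moreover have "potential E W = potential (edges_in E U) W"
    proof -
      have "edges_in (edges_in E U) W = edges_in E W" using W(1) by (auto simp: edges_in_def)
      then show ?thesis by (simp add: potential_def)
    qed
    ultimately show False by linarith
  qed
  then obtain c where c: "coloring U F c" by (auto simp: colorable_iff)
  have "coloring U E c" using c by (auto simp: coloring_def F_def edges_in_def)
  moreover have "c a \<noteq> c b" using c ab by (auto simp: coloring_def F_def)
  ultimately show ?thesis using that by blast
qed

text \<open>The vertices of \<open>R\<close> with a neighbour outside (the set \<open>S\<close>)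
  separate the rest of \<open>R\<close> from \<open>V - R\<close>, so 2-connectedness requires two
  of them.\<close>

lemma boundary:
  assumes R: "R \<subset> V" "card R \<ge> 2"
  obtains u v w z where "u \<in> R" "v \<in> R" "u \<noteq> v" "w \<in> V - R" "z \<in> V - R" "{u,w} \<in> E" "{v,z} \<in> E"
proof -
  define S where "S = {u\<in>R. \<exists>w\<in>V-R. {u,w} \<in> E}"
  have finS: "finite S" using R(1) finV by (auto simp: S_def intro: finite_subset)
  have "card S \<ge> 2"
  proof (rule ccontr)
    assume "\<not> card S \<ge> 2"
    then have c1: "card S \<le> 1" by simp
    define B where "B = (V - R) \<union> S"
    have "R \<union> B = V" "R \<noteq> V" using R(1) by (auto simp: B_def S_def)
    moreover have "R \<inter> B = S" by (auto simp: B_def S_def)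
    moreover have "B \<noteq> V"
    proof
      assume "B = V"
      then have "R \<subseteq> S" using R(1) by (auto simp: B_def)
      then have "card R \<le> card S" using card_mono[OF finS] by blast
      then show False using c1 R(2) by simp
    qed
    ultimately obtain e where e: "e \<in> E" "\<not> e \<subseteq> R" "\<not> e \<subseteq> B" using critical_no_separation[OF crit, of R B] c1 by auto
    obtain s t where st: "e = {s,t}" "s \<in> V" "t \<in> V" using e(1) sg by (auto simp: simple_graph_def)
    have "s \<in> R \<and> s \<notin> S \<and> t \<notin> R \<or> t \<in> R \<and> t \<notin> S \<and> s \<notin> R" using e(2,3) st by (auto simp: B_def)
    then show False using e(1) st by (auto simp: S_def insert_commute)
  qed
  then obtain T where "T \<subseteq> S" "card T = 2" by (rule obtain_subset_with_card_n)
  then obtain u v where "u \<in> S" "v \<in> S" "u \<noteq> v" by (auto simp: card_2_iff)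
  then show ?thesis using that by (auto simp: S_def)
qed

text \<open>The coloring to collapse is chosen with different colors on two vertices
  \<open>u\<close>, \<open>v\<close> that have neighbours outside. If only one class is in
  \<open>I\<close>, the outgoing edge of \<open>u\<close> or \<open>v\<close> is a bonus edge; if
  there are more, the second estimate of \<open>collapse\<close> saves one. Either way the potential
  of \<open>V\<close> falls below 3.\<close>

lemma potential_ge_7:
  assumes R: "R \<subset> V" "card R \<ge> 4"
  shows "potential E R \<ge> 7"
proof (rule ccontr)
  assume "\<not> potential E R \<ge> 7"
  then have p6: "potential E R \<le> 6" by simp
  have "card R \<ge> 2" using R(2) by simp
  then obtain u v w z where uv: "u \<in> R" "v \<in> R" "u \<noteq> v" "w \<in> V - R" "z \<in> V - R" "{u,w} \<in> E" "{v,z} \<in> E"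
    using boundary[OF R(1)] by blast
  obtain \<phi> where phi: "coloring R E \<phi>" "\<phi> u \<noteq> \<phi> v" using ex_coloring_distinct[OF R(1) uv(1-3)] .
  obtain W' I where W': "W' \<subseteq> V - R" "I \<subseteq> {..<3}" "I \<noteq> {}"
    "potential E (R \<union> W') + 3 * int (card {e\<in>E. \<exists>u\<in>R. \<exists>w\<in>W'. e = {u,w} \<and> \<phi> u \<notin> I}) \<le> potential E R - 3"
    "card I \<noteq> 1 \<Longrightarrow> potential E (R \<union> W') \<le> potential E R - 4"
    using collapse[OF R, of \<phi>] phi(1) unfolding coloring_def by blast
  let ?S = "{e\<in>E. \<exists>u\<in>R. \<exists>w\<in>W'. e = {u,w} \<and> \<phi> u \<notin> I}"
  \<comment> \<open>Potential 3 is too small for a proper subset, so the superset is all of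
    \<open>V\<close> and \<open>W'\<close> contains the outside neighbours \<open>w\<close> and
    \<open>z\<close>.\<close>
  have le3: "potential E (R \<union> W') \<le> 3" using W'(4) p6 by linarith
  have RW: "R \<union> W' = V"
  proof (rule ccontr)
    assume "R \<union> W' \<noteq> V"
    then have "R \<union> W' \<subset> V" using R(1) W'(1) by blast
    moreover have "card R \<le> card (R \<union> W')" using W'(1) finV R(1) by (intro card_mono) (auto intro: finite_subset)
    ultimately show False using potential_ge_6[of "R \<union> W'"] R(2) le3 by simp
  qed
  show False
  proof (cases "card I = 1")
    case False then show ?thesis using W'(5) p6 pot RW by simp
  next
    case True
    then obtain i where i: "I = {i}" using card_1_singletonE by blast
    have W'eq: "W' = V - R" using RW W'(1) by blast
    have "?S \<noteq> {}"
    proof (cases "\<phi> u = i")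
      case True
      then have "\<phi> v \<notin> I" using phi(2) i by auto
      then show ?thesis using uv W'eq by blast
    next
      case False
      then have "\<phi> u \<notin> I" using i by auto
      then show ?thesis using uv W'eq by blast
    qed
    then have "card ?S \<ge> 1" using finE by (simp add: Suc_leI card_gt_0_iff)
    then show ?thesis using W'(4) p6 RW pot by simp
  qed
qed

text \<open>Identify \<open>a\<close> with \<open>z\<close>. A coloring of the quotient would give
  both the same color, so by \<open>no\<close> there is none. The bad set supplied by
  \<open>IH\<close> must contain \<open>z\<close>, and putting \<open>a\<close> back adds at most 5
  to a potential of at most 2.\<close>

lemma merge:
  assumes U: "U \<subset> V" and za: "z \<in> U" "a \<in> U" "z \<noteq> a" "{z,a} \<notin> E"
    and no: "\<And>c. coloring U E c \<Longrightarrow> c z \<noteq> c a"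
  obtains W where "W \<subseteq> U" "z \<in> W" "a \<in> W" "card W \<ge> 3" "potential E W \<le> 7"
proof -
  define f where "f v = (if v = a then z else v)" for v
  define U' where "U' = U - {a}"
  define F where "F = (`) f ` edges_in E U"
  have finU: "finite U" using U finV finite_subset by blast
  have sgF: "simple_graph U' F"
    unfolding simple_graph_def F_def
  proof
    fix h assume "h \<in> (`) f ` edges_in E U"
    then obtain e where e: "e \<in> E" "e \<subseteq> U" "h = f ` e" by (auto simp: edges_in_def)
    then obtain u v where uv: "e = {u,v}" "u \<noteq> v" using sg by (auto simp: simple_graph_def)
    have "f u \<noteq> f v" using uv e(1) za(4) by (auto simp: f_def insert_commute)
    moreover have "f u \<in> U'" "f v \<in> U'" using uv e(2) za by (auto simp: f_def U'_def)
    ultimately show "\<exists>u v. h = {u, v} \<and> u \<noteq> v \<and> u \<in> U' \<and> v \<in> U'" using e(3) uv by auto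
  qed
  have nc: "\<not> proper_3_colorable U' F"
  proof
    assume "proper_3_colorable U' F"
    then obtain c where c: "coloring U' F c" by (auto simp: colorable_iff)
    have fU: "f v \<in> U'" if "v \<in> U" for v using that za by (auto simp: f_def U'_def)
    have "coloring U E (\<lambda>v. c (f v))"
      unfolding coloring_def
    proof (intro conjI ballI impI)
      fix v assume "v \<in> U" then show "c (f v) < 3" using c fU by (auto simp: coloring_def)
    next
      fix u v assume uv: "u \<in> U" "v \<in> U" "{u,v} \<in> E"
      then have "f ` {u,v} \<in> F" unfolding F_def by (intro imageI) (auto simp: edges_in_def)
      then show "c (f u) \<noteq> c (f v)" using c fU uv by (auto simp: coloring_def)
    qed
    then show False using no[of "\<lambda>v. c (f v)"] by (simp add: f_def)
  qed
  have "card U' < card V" using psubset_card_mono[OF finV, of U'] U by (auto simp: U'_def)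
  then obtain W0 where W0: "W0 \<subseteq> U'" "\<not> proper_3_colorable W0 (edges_in F W0)" "potential F W0 \<le> 2"
    using IH[OF _ _ sgF nc] finU by (auto simp: U'_def)
  have finW0: "finite W0" using W0(1) finU by (auto simp: U'_def intro: finite_subset)
  have zW0: "z \<in> W0"
  proof (rule ccontr)
    assume z: "z \<notin> W0"
    have "edges_in F W0 \<subseteq> edges_in E W0"
    proof
      fix h assume "h \<in> edges_in F W0"
      then obtain e where e: "e \<in> E" "h = f ` e" "f ` e \<subseteq> W0" by (auto simp: edges_in_def F_def)
      have "a \<notin> e" using e(3) z by (auto simp: f_def split: if_splits)
      then have "f ` e = e" by (auto simp: f_def image_iff)
      then show "h \<in> edges_in E W0" using e by (auto simp: edges_in_def)
    qed
    then have "\<not> proper_3_colorable W0 (edges_in E W0)" using W0(2) colorable_mono by blast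
    then have "W0 = V" using critical_noncolorable_eq[OF crit] W0(1) U by (auto simp: U'_def)
    then show False using W0(1) U by (auto simp: U'_def)
  qed
  have aW0: "a \<notin> W0" using W0(1) by (auto simp: U'_def)
  have "edges_in F W0 \<subseteq> (`) f ` edges_in E (insert a W0)"
  proof
    fix h assume "h \<in> edges_in F W0"
    then obtain e where e: "e \<in> E" "h = f ` e" "f ` e \<subseteq> W0" by (auto simp: edges_in_def F_def)
    have "v \<in> insert a W0" if "v \<in> e" for v using e(3) that by (auto simp: f_def split: if_splits)
    then show "h \<in> (`) f ` edges_in E (insert a W0)" using e by (auto simp: edges_in_def)
  qed
  then have "card (edges_in F W0) \<le> card (edges_in E (insert a W0))"
    using finite_edges_in[of "insert a W0" E] finW0 by (meson card_image_le card_mono finite.insertI finite_imageI order_trans)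
  then have pW: "potential E (insert a W0) \<le> 7" using W0(3) aW0 finW0 by (simp add: potential_def)
  have "card W0 \<ge> 2" using card_ge_2_of_potential[OF sgF finW0 _ W0(3)] zW0 by blast
  then have "card (insert a W0) \<ge> 3" using aW0 finW0 by simp
  then show ?thesis using that[of "insert a W0"] pW zW0 W0(1) za by (auto simp: U'_def)
qed

end

section \<open>Degree sums and the vertices of degree 3\<close>

lemma card_incident:
  assumes "simple_graph V E"
  shows "card {e\<in>E. v \<in> e} = card (nbrs E v)"
proof -
  have "bij_betw (\<lambda>w. {v,w}) (nbrs E v) {e\<in>E. v \<in> e}"
  proof (rule bij_betw_imageI)
    show "inj_on (\<lambda>w. {v, w}) (nbrs E v)" by (auto simp: inj_on_def doubleton_eq_iff)
    have "\<exists>w. e = {v,w}" if e: "e \<in> E" "v \<in> e" for e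
    proof -
      obtain a b where "e = {a,b}" using e(1) assms unfolding simple_graph_def by blast
      then show ?thesis using e(2) by auto
    qed
    then show "(\<lambda>w. {v, w}) ` nbrs E v = {e \<in> E. v \<in> e}" by (auto simp: nbrs_def)
  qed
  then show ?thesis by (simp add: bij_betw_same_card)
qed

lemma handshake:
  assumes "simple_graph V E" "finite V"
  shows "(\<Sum>v\<in>V. card (nbrs E v)) = 2 * card E"
proof -
  have "card {v\<in>V. v \<in> e} = 2" if "e \<in> E" for e
  proof -
    have "{v\<in>V. v \<in> e} = e" using simple_graphD[OF assms(1) that] by auto
    then show ?thesis using simple_graphD[OF assms(1) that] by simp
  qed
  then have "(\<Sum>v\<in>V. card {e\<in>E. v \<in> e}) = (\<Sum>e\<in>E. 2)"
    by (intro sum_multicount_gen) (use assms simple_graph_finite in auto)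
  then show ?thesis by (simp add: card_incident[OF assms(1)])
qed

text \<open>For two adjacent vertices that see a common neighbour of color \<open>p\<close> and
  private ones of colors \<open>q\<close> and \<open>r\<close>. Distinct free colors are missing
  only if \<open>q = r\<close> and \<open>q \<noteq> p\<close>: then both vertices are left with the
  same single color.\<close>

lemma two_free_colors:
  assumes "p = q \<or> p = r \<or> q \<noteq> r" "p < 3" "q < 3" "r < (3::nat)"
  obtains i j where "i < (3::nat)" "j < (3::nat)" "i \<noteq> j" "i \<notin> {p,q}" "j \<notin> {p,r}"
proof -
  have c2: "card {s,t} \<le> 2" "finite {s,t}" for s t :: nat by (auto simp: card_insert_if)
  consider "p = q" | "p = r" | "p \<noteq> q" "p \<noteq> r" "q \<noteq> r" using assms(1) by blast
  then show ?thesis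
  proof cases
    case 1
    obtain j where j: "j < 3" "j \<notin> {p,r}" using free_color c2 by blast
    obtain i where "i < 3" "i \<notin> {p,j}" using free_color c2 by blast
    then show ?thesis using that[of i j] j 1 by auto
  next
    case 2
    obtain i where i: "i < 3" "i \<notin> {p,q}" using free_color c2 by blast
    obtain j where "j < 3" "j \<notin> {p,i}" using free_color c2 by blast
    then show ?thesis using that[of i j] i 2 by auto
  next
    case 3
    then show ?thesis using that[of r q] assms by auto
  qed
qed

lemma card_3_obtain:
  assumes "card S = 3" "y \<in> S" "z \<in> S" "y \<noteq> z"
  obtains a where "S = {y,z,a}" "a \<noteq> y" "a \<noteq> z"
proof -
  have fin: "finite S" by (rule card_ge_0_finite) (simp add: assms(1))
  have "card (S - {y,z}) = 1" using assms fin by (simp add: card_Diff_subset)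
  then obtain a where "S - {y,z} = {a}" using card_1_singletonE by blast
  then show ?thesis using that[of a] assms(2,3) by blast
qed

lemma potential_superset:
  assumes "finite R" "W \<subseteq> R" "Q \<subseteq> edges_in E R" "Q \<inter> edges_in E W = {}"
  shows "potential E R \<le> potential E W + 5 * (int (card R) - int (card W)) - 3 * int (card Q)"
proof -
  have "edges_in E W \<union> Q \<subseteq> edges_in E R" using assms(2,3) by (auto simp: edges_in_def)
  then have "card (edges_in E W \<union> Q) \<le> card (edges_in E R)"
    using finite_edges_in[OF assms(1)] by (intro card_mono)
  moreover have "card (edges_in E W \<union> Q) = card (edges_in E W) + card Q"
    using assms finite_edges_in[OF assms(1), of E] finite_edges_in[of W E] finite_subset
    by (intro card_Un_disjoint) (auto dest: finite_subset)
  ultimately show ?thesis by (simp add: potential_def)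
qed

context minimal_counterexample
begin

lemma potential_gt_2:
  assumes "R \<subseteq> V" "card R \<ge> 2"
  shows "potential E R \<ge> 3"
  using potential_ge_6[of R] pot assms by (cases "R = V") force+

lemma edge_sym: "{u,v} \<in> E \<Longrightarrow> {v,u} \<in> E" by (simp add: insert_commute)

lemma edge_ne: "{u,v} \<in> E \<Longrightarrow> u \<noteq> v" using nbrs_subset[OF sg, of u] by (auto simp: nbrs_def)

lemma edge_V: "{u,v} \<in> E \<Longrightarrow> u \<in> V \<and> v \<in> V" using sg by (auto simp: simple_graph_iff)

text \<open>Let \<open>a\<close> and \<open>b\<close> be the third neighbours of \<open>x\<close>
  and \<open>y\<close>. No coloring of \<open>V - {x,y}\<close> extends, so each gives
  \<open>a\<close> and \<open>b\<close> one color, different from that of \<open>z\<close>. If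
  \<open>a \<noteq> b\<close>, \<open>ex_coloring_distinct\<close> refutes this. If
  \<open>a = b\<close>, either \<open>x\<close>, \<open>y\<close>, \<open>z\<close>,
  \<open>a\<close> span a complete graph or \<open>merge\<close> gives a set of too small
  potential.\<close>

lemma triangle_degrees:
  assumes tri: "{x,y} \<in> E" "{x,z} \<in> E" "{y,z} \<in> E"
    and deg: "card (nbrs E x) = 3" "card (nbrs E y) = 3"
  shows False
proof -
  note ne = tri[THEN edge_ne]
  obtain a where a: "nbrs E x = {y,z,a}" "a \<noteq> y" "a \<noteq> z"
    using card_3_obtain[OF deg(1), of y z] tri ne by (auto simp: nbrs_def)
  obtain b where b: "nbrs E y = {x,z,b}" "b \<noteq> x" "b \<noteq> z"
    using card_3_obtain[OF deg(2), of x z] tri ne by (auto simp: nbrs_def insert_commute)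
  have xa: "{x,a} \<in> E" using a(1) by (auto simp: nbrs_def)
  have yb: "{y,b} \<in> E" using b(1) by (auto simp: nbrs_def)
  have ax: "a \<noteq> x" and yb_ne: "b \<noteq> y" using edge_ne[OF xa] edge_ne[OF yb] by auto
  have inV: "x \<in> V" "y \<in> V" "z \<in> V" "a \<in> V" "b \<in> V" using edge_V tri xa yb by blast+
  have bad: "c a = c b \<and> c z \<noteq> c a" if c: "coloring (V - {x,y}) E c" for c
  proof (rule ccontr)
    assume *: "\<not> (c a = c b \<and> c z \<noteq> c a)"
    have "c z < 3" "c a < 3" "c b < 3" using c inV ne ax yb_ne a b by (auto simp: coloring_def)
    moreover have "c z = c a \<or> c z = c b \<or> c a \<noteq> c b" using * by auto
    ultimately obtain i j where ij: "i < 3" "j < 3" "i \<noteq> j" "i \<notin> {c z,c a}" "j \<notin> {c z,c b}"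
      using two_free_colors[of "c z" "c a" "c b"] by metis
    have "c ` (nbrs E x - {y}) \<subseteq> {c z, c a}" "c ` (nbrs E y - {x}) \<subseteq> {c z, c b}" using a b by auto
    then show False using extend2[OF c, of i j] ij ne by blast
  qed
  have U: "V - {x,y} \<subset> V" using inV by blast
  show False
  proof (cases "a = b")
    case False
    obtain c where "coloring (V - {x,y}) E c" "c a \<noteq> c b"
      using ex_coloring_distinct[OF U, of a b] inV ax yb_ne a b False by auto
    then show False using bad by blast
  next
    case True
    have ya: "{y,a} \<in> E" using yb True by simp
    show False
    proof (cases "{z,a} \<in> E")
      case True
      \<comment> \<open>Six edges on four vertices: potential at most 20 - 18 = 2.\<close>
      have "card {{x,y},{x,z},{x,a},{y,z},{y,a},{z,a}} = 6" using ne ax a by (simp add: doubleton_eq_iff)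
      moreover have "{{x,y},{x,z},{x,a},{y,z},{y,a},{z,a}} \<subseteq> edges_in E {x,y,z,a}"
        using tri xa ya True by (auto simp: edges_in_def)
      ultimately have "6 \<le> card (edges_in E {x,y,z,a})"
        using card_mono[OF finite_edges_in[of "{x,y,z,a}" E]] by (metis finite.emptyI finite.insertI)
      moreover have c4: "card {x,y,z,a} = 4" using ne ax a by simp
      ultimately have "potential E {x,y,z,a} \<le> 2" unfolding potential_def by simp
      moreover have "potential E {x,y,z,a} \<ge> 3" using potential_gt_2[of "{x,y,z,a}"] inV c4 by simp
      ultimately show False by simp
    next
      case False
      obtain W where W: "W \<subseteq> V - {x,y}" "z \<in> W" "a \<in> W" "card W \<ge> 3" "potential E W \<le> 7"
        using merge[OF U, of z a] inV ne ax a False bad by blast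
      have finW: "finite W" using W(1) finV by (meson finite_Diff finite_subset)
      \<comment> \<open>Two new vertices and at least five new edges: 7 + 10 - 15 = 2.\<close>
      define R where "R = insert x (insert y W)"
      have cR: "card R = card W + 2" using W(1) finW ne by (auto simp: R_def card_insert_if)
      have "potential E R \<le> potential E W + 5 * (int (card R) - int (card W))
          - 3 * int (card {{x,y},{x,z},{x,a},{y,z},{y,a}})"
        by (rule potential_superset) (use tri xa ya W finW in \<open>auto simp: R_def edges_in_def\<close>)
      moreover have "card {{x,y},{x,z},{x,a},{y,z},{y,a}} = 5" using ne ax a by (simp add: doubleton_eq_iff)
      ultimately have "potential E R \<le> 2" using W(5) cR by simp
      moreover have "potential E R \<ge> 3"
        by (rule potential_gt_2) (use W inV cR in \<open>auto simp: R_def\<close>)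
      ultimately show False by simp
    qed
  qed
qed

text \<open>If \<open>a\<close> and \<open>b\<close> are not adjacent, a coloring of
  \<open>V - {x,y}\<close> that gives them one color extends: \<open>y\<close> has two other
  neighbours and takes a free color \<open>j\<close>, and \<open>x\<close> only has to avoid
  \<open>j\<close> and the color of \<open>a\<close>. So \<open>merge\<close> applies, and adding
  \<open>x\<close> with its edges to \<open>a\<close> and \<open>b\<close> leaves potential at most
  7 + 5 - 6 = 6, against \<open>potential_ge_7\<close>.\<close>

lemma adjacent_degree_3:
  assumes x: "nbrs E x = {y,a,b}" "a \<noteq> b" "y \<noteq> a" "y \<noteq> b" and y: "card (nbrs E y) = 3"
  shows "{a,b} \<in> E"
proof (rule ccontr)
  assume nab: "{a,b} \<notin> E"
  have xe: "{x,y} \<in> E" "{x,a} \<in> E" "{x,b} \<in> E" using x(1) by (auto simp: nbrs_def)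
  note ne = xe[THEN edge_ne]
  have inV: "x \<in> V" "y \<in> V" "a \<in> V" "b \<in> V" using edge_V xe by blast+
  have U: "V - {x,y} \<subset> V" using inV by blast
  have "card (nbrs E y - {x}) = 2"
    using y edge_sym[OF xe(1)] by (subst card_Diff_singleton) (auto simp: nbrs_def)
  then have fin: "finite (c ` (nbrs E y - {x}))" "card (c ` (nbrs E y - {x})) \<le> 2" for c :: "'a \<Rightarrow> nat"
  proof -
    have "finite (nbrs E y - {x})" by (rule card_ge_0_finite) (simp add: \<open>card (nbrs E y - {x}) = 2\<close>)
    then show "finite (c ` (nbrs E y - {x}))" "card (c ` (nbrs E y - {x})) \<le> 2"
      using card_image_le[of "nbrs E y - {x}" c] \<open>card (nbrs E y - {x}) = 2\<close> by auto
  qed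
  have no: "c a \<noteq> c b" if c: "coloring (V - {x,y}) E c" for c
  proof
    assume ab: "c a = c b"
    obtain j where j: "j < 3" "j \<notin> c ` (nbrs E y - {x})" using free_color fin by blast
    have "card {c a, j} \<le> 2" by (cases "c a = j") auto
    then obtain i where i: "i < 3" "i \<notin> {c a, j}" using free_color[of "{c a, j}"] by blast
    have "c ` (nbrs E x - {y}) \<subseteq> {c a}" using x ab by auto
    then show False using extend2[OF c, of i j] i j ne by blast
  qed
  obtain W where W: "W \<subseteq> V - {x,y}" "a \<in> W" "b \<in> W" "card W \<ge> 3" "potential E W \<le> 7"
    using merge[OF U, of a b] inV ne x nab no by blast
  have finW: "finite W" using W(1) finV by (meson finite_Diff finite_subset)
  have xW: "x \<notin> W" using W(1) by blast
  have "potential E (insert x W) \<le> potential E W + 5 * (int (card (insert x W)) - int (card W))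
          - 3 * int (card {{x,a},{x,b}})"
    by (rule potential_superset) (use xe W finW in \<open>auto simp: edges_in_def\<close>)
  moreover have "card {{x,a},{x,b}} = 2" using ne x by (simp add: doubleton_eq_iff)
  ultimately have "potential E (insert x W) \<le> 6" using W(5) xW finW by simp
  moreover have "potential E (insert x W) \<ge> 7"
    by (rule potential_ge_7) (use W inV xW finW ne in auto)
  ultimately show False by simp
qed

text \<open>Given two neighbours \<open>y\<close>, \<open>y'\<close> of degree 3,
  \<open>adjacent_degree_3\<close> for \<open>y\<close> makes \<open>x\<close>, \<open>y'\<close>
  and the third neighbour a triangle in which \<open>x\<close> and \<open>y'\<close> both have
  degree 3.\<close>

lemma degree_3_neighbours:
  assumes "card (nbrs E x) = 3"
  shows "card {w \<in> nbrs E x. card (nbrs E w) \<noteq> 3} \<ge> 2"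
proof -
  let ?B = "{w \<in> nbrs E x. card (nbrs E w) = 3}"
  have fin: "finite (nbrs E x)" by (rule card_ge_0_finite) (simp add: assms)
  have "card ?B \<le> 1"
  proof (rule ccontr)
    assume "\<not> card ?B \<le> 1"
    then have "2 \<le> card ?B" by simp
    then obtain T where T: "T \<subseteq> ?B" "card T = 2" by (rule obtain_subset_with_card_n)
    then obtain y y' where yy: "y \<noteq> y'" "y \<in> ?B" "y' \<in> ?B" by (auto simp: card_2_iff)
    then have yx: "y \<in> nbrs E x" "y' \<in> nbrs E x" "card (nbrs E y) = 3" "card (nbrs E y') = 3" by auto
    obtain b where b: "nbrs E x = {y,y',b}" "b \<noteq> y" "b \<noteq> y'" by (rule card_3_obtain[OF assms yx(1,2) yy(1)])
    have "{y',b} \<in> E" using adjacent_degree_3[OF b(1) _ yy(1) _ yx(3)] b(2,3) by blast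
    moreover have "{x,y'} \<in> E" "{x,b} \<in> E" using b(1) by (auto simp: nbrs_def)
    ultimately show False using triangle_degrees[of x y' b] assms yx(4) by blast
  qed
  moreover have "card (nbrs E x) \<le> card ?B + card {w \<in> nbrs E x. card (nbrs E w) \<noteq> 3}"
  proof -
    have "?B \<union> {w \<in> nbrs E x. card (nbrs E w) \<noteq> 3} = nbrs E x" by auto
    with card_Un_le[of ?B "{w \<in> nbrs E x. card (nbrs E w) \<noteq> 3}"] show ?thesis by (simp only:)
  qed
  ultimately show ?thesis using assms by linarith
qed

text \<open>Count the edges between \<open>T\<close> and \<open>B\<close>: at least two for each
  vertex of \<open>T\<close>, and at most the degree sum over \<open>B\<close>.\<close>

lemma minimal_counterexample_absurd: False
proof -
  define T where "T = {v\<in>V. card (nbrs E v) = 3}"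
  define B where "B = V - T"
  have fin: "finite T" "finite B" using finV by (auto simp: T_def B_def)
  have B4: "card (nbrs E v) \<ge> 4" if "v \<in> B" for v
    using critical_min_degree[OF crit, of v] that by (auto simp: B_def T_def)
  have nbV: "nbrs E v \<subseteq> V" for v using nbrs_subset[OF sg] by blast
  have finn: "finite (nbrs E v)" for v using nbV finV finite_subset by blast
  have "2 * card T = (\<Sum>v\<in>T. 2)" by simp
  also have "\<dots> \<le> (\<Sum>v\<in>T. card {w\<in>B. w \<in> nbrs E v})"
  proof (rule sum_mono)
    fix v assume "v \<in> T"
    then have "2 \<le> card {w \<in> nbrs E v. card (nbrs E w) \<noteq> 3}" using degree_3_neighbours by (simp add: T_def)
    also have "{w \<in> nbrs E v. card (nbrs E w) \<noteq> 3} = {w\<in>B. w \<in> nbrs E v}" using nbV by (auto simp: B_def T_def)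
    finally show "2 \<le> card {w\<in>B. w \<in> nbrs E v}" .
  qed
  also have "\<dots> = (\<Sum>w\<in>B. card {v\<in>T. w \<in> nbrs E v})"
    by (rule sum_multicount_gen) (use fin in auto)
  also have "\<dots> \<le> (\<Sum>w\<in>B. card (nbrs E w))"
    by (intro sum_mono card_mono finn) (auto simp: nbrs_sym)
  finally have 1: "2 * card T \<le> (\<Sum>w\<in>B. card (nbrs E w))" .
  have 2: "4 * card B \<le> (\<Sum>w\<in>B. card (nbrs E w))"
    using sum_mono[of B "\<lambda>_. 4" "\<lambda>w. card (nbrs E w)"] B4 by (simp add: mult.commute)
  have "V = T \<union> B" "T \<inter> B = {}" by (auto simp: T_def B_def)
  then have 3: "card V = card T + card B" "2 * card E = (\<Sum>w\<in>T. card (nbrs E w)) + (\<Sum>w\<in>B. card (nbrs E w))"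
    using handshake[OF sg finV] fin by (simp_all add: card_Un_disjoint sum.union_disjoint)
  have "(\<Sum>w\<in>T. card (nbrs E w)) = 3 * card T" by (simp add: T_def)
  \<comment> \<open>With s the degree sum over \<open>B\<close>, half of \<open>1\<close> plus five
    halves of \<open>2\<close> gives |T| + 10|B| <= 3s, hence 10|V| <= 9|T| + 3s = 6|E|.\<close>
  then have "5 * card V \<le> 3 * card E" using 1 2 3 by linarith
  then show False using pot edges_in_self[OF sg] by (simp add: potential_def)
qed

end

theorem critical_potential:
  assumes "critical V E"
  shows "potential E V \<le> 2"
  using assms
proof (induction "card V" arbitrary: V E rule: less_induct)
  case less
  show ?case
  proof (rule ccontr)
    assume pot: "\<not> potential E V \<le> 2"
    interpret minimal_counterexample V E
    proof
      fix V' :: "'a set" and E' assume V': "finite V'" "card V' < card V" "simple_graph V' E'"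
        "\<not> proper_3_colorable V' E'"
      \<comment> \<open>The induction is on critical graphs, so it is applied to a critical
        subgraph; the further edges of \<open>E'\<close> inside \<open>W\<close> only lower the
        potential.\<close>
      obtain W F where WF: "W \<subseteq> V'" "F \<subseteq> edges_in E' W" "critical W F" using exists_critical[OF V'(1,3,4)] .
      have finW: "finite W" using WF(1) V'(1) finite_subset by blast
      have "card W \<le> card V'" using WF(1) V'(1) card_mono by blast
      then have "potential F W \<le> 2" using less.hyps WF(3) V'(2) by simp
      moreover have "potential E' W \<le> potential F W"
        by (rule potential_edge_mono[OF finW]) (use WF(2) in \<open>auto simp: edges_in_def\<close>)
      moreover have "\<not> proper_3_colorable W (edges_in E' W)"
      proof
        assume "proper_3_colorable W (edges_in E' W)"
        then have "proper_3_colorable W F" using WF(2) by (rule colorable_mono[OF _ order_refl])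
        then show False using WF(3) by (simp add: critical_def)
      qed
      ultimately show "\<exists>W\<subseteq>V'. \<not> proper_3_colorable W (edges_in E' W) \<and> potential E' W \<le> 2"
        using WF(1) by (meson order_trans)
    qed (use less.prems pot in simp_all)
    show False by (rule minimal_counterexample_absurd)
  qed
qed

section \<open>Theta curves\<close>

lemma connected_subset_inside:
  assumes "connected S" "S \<inter> J = {}" "S \<inter> inside J \<noteq> {}"
  shows "S \<subseteq> inside J"
proof
  fix y assume "y \<in> S"
  obtain x where x: "x \<in> S" "x \<in> inside J" using assms(3) by blast
  have "connected_component (- J) x y"
    unfolding connected_component_def using assms x \<open>y \<in> S\<close> by blast
  then show "y \<in> inside J" using x inside_same_component by metis
qed

lemma connected_subset_outside:
  assumes "connected S" "S \<inter> J = {}" "S \<inter> outside J \<noteq> {}"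
  shows "S \<subseteq> outside J"
proof
  fix y assume "y \<in> S"
  obtain x where x: "x \<in> S" "x \<in> outside J" using assms(3) by blast
  have "connected_component (- J) x y"
    unfolding connected_component_def using assms x \<open>y \<in> S\<close> by blast
  then show "y \<in> outside J" using x outside_same_component by metis
qed

lemma outside_iff: "x \<in> outside J \<longleftrightarrow> x \<notin> J \<and> x \<notin> inside J"
  using inside_Un_outside[of J] inside_Int_outside[of J] by blast

lemma inside_not_in: "x \<in> inside J \<Longrightarrow> x \<notin> J"
  using inside_no_overlap[of J] by blast

lemma arcs_simple_closed_path:
  assumes "arc c1" "arc c2" "pathstart c1 = a" "pathfinish c1 = b" "pathstart c2 = a" "pathfinish c2 = b"
    "path_image c1 \<inter> path_image c2 = {a,b}"
  shows "simple_path (c1 +++ reversepath c2)" "pathfinish (c1 +++ reversepath c2) = pathstart (c1 +++ reversepath c2)"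
    "path_image (c1 +++ reversepath c2) = path_image c1 \<union> path_image c2"
  using assms by (auto simp: simple_path_join_loop_eq arc_reversepath path_image_join)

lemma arcs_jordan:
  fixes c1 c2 :: "real \<Rightarrow> complex"
  assumes "arc c1" "arc c2" "pathstart c1 = a" "pathfinish c1 = b" "pathstart c2 = a" "pathfinish c2 = b"
    "path_image c1 \<inter> path_image c2 = {a,b}"
  defines "J \<equiv> path_image c1 \<union> path_image c2"
  shows "inside J \<noteq> {}" "open (inside J)" "connected (inside J)" "bounded (inside J)" "frontier (inside J) = J"
    "outside J \<noteq> {}" "open (outside J)" "connected (outside J)" "\<not> bounded (outside J)" "frontier (outside J) = J"
  using Jordan_inside_outside[OF arcs_simple_closed_path(1,2)[OF assms(1-7)]]
  unfolding arcs_simple_closed_path(3)[OF assms(1-7)] J_def by auto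

lemma arc_other_point:
  assumes "arc c"
  obtains x where "x \<in> path_image c" "x \<noteq> pathstart c" "x \<noteq> pathfinish c"
proof
  show "c (1/2) \<in> path_image c" by (simp add: path_image_def)
  show "c (1/2) \<noteq> pathstart c" "c (1/2) \<noteq> pathfinish c"
    using inj_onD[OF arc_imp_inj_on[OF assms], of "1/2" 0] inj_onD[OF arc_imp_inj_on[OF assms], of "1/2" 1]
    by (auto simp: pathstart_def pathfinish_def)
qed

context
  fixes c1 c2 c :: "real \<Rightarrow> complex" and a b
  assumes arcs: "arc c1" "arc c2" "arc c"
    and ends: "pathstart c1 = a" "pathfinish c1 = b" "pathstart c2 = a" "pathfinish c2 = b"
      "pathstart c = a" "pathfinish c = b"
    and ints: "path_image c1 \<inter> path_image c2 = {a,b}" "path_image c1 \<inter> path_image c = {a,b}"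
      "path_image c2 \<inter> path_image c = {a,b}"
begin

text \<open>The two passes along \<open>c\<close> in opposite directions cancel.\<close>

lemma theta_winding:
  assumes "z \<notin> path_image c1" "z \<notin> path_image c2" "z \<notin> path_image c"
  shows "winding_number (c1 +++ reversepath c2) z =
    winding_number (c1 +++ reversepath c) z + winding_number (c +++ reversepath c2) z"
  using assms arcs ends
  by (simp add: winding_number_join winding_number_reversepath arc_imp_path)

text \<open>Each inside is connected and misses the other curve. If they met, each would contain the
  other, so the curves would agree as common frontier; but \<open>c\<close> has a point off the
  curve formed by \<open>c1\<close> and \<open>c2\<close>.\<close>

lemma theta_insides_equal:
  assumes "path_image c2 \<inter> inside (path_image c1 \<union> path_image c) = {}"
    and "path_image c \<inter> inside (path_image c1 \<union> path_image c2) = {}"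
  shows "inside (path_image c1 \<union> path_image c) \<inter> inside (path_image c1 \<union> path_image c2) = {}"
proof (rule ccontr)
  assume ne: "\<not> ?thesis"
  let ?J = "path_image c1 \<union> path_image c" and ?J' = "path_image c1 \<union> path_image c2"
  note j = arcs_jordan[OF arcs(1,3) ends(1,2,5,6) ints(2)]
  note j' = arcs_jordan[OF arcs(1,2) ends(1-4) ints(1)]
  have "inside ?J \<inter> ?J' = {}" using assms(1) inside_no_overlap[of ?J] by blast
  then have 1: "inside ?J \<subseteq> inside ?J'" using connected_subset_inside[OF j(3)] ne by blast
  have "inside ?J' \<inter> ?J = {}" using assms(2) inside_no_overlap[of ?J'] by blast
  then have "inside ?J' \<subseteq> inside ?J" using connected_subset_inside[OF j'(3)] ne by blast
  then have "?J = ?J'" using j(5) j'(5) 1 by (metis subset_antisym)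
  moreover obtain x where "x \<in> path_image c" "x \<noteq> a" "x \<noteq> b" using arc_other_point[OF arcs(3)] ends by metis
  ultimately show False using ints by blast
qed

end

text \<open>If the interiors of the three arcs were pairwise outside the closed curve formed by the other
  two, the three insides would be disjoint; but the winding numbers around a point of one inside
  add up, so that point is inside a second curve.\<close>

lemma theta_nested:
  fixes c1 c2 c :: "real \<Rightarrow> complex"
  assumes arcs: "arc c1" "arc c2" "arc c"
    and ends: "pathstart c1 = a" "pathfinish c1 = b" "pathstart c2 = a" "pathfinish c2 = b"
      "pathstart c = a" "pathfinish c = b"
    and ints: "path_image c1 \<inter> path_image c2 = {a,b}" "path_image c1 \<inter> path_image c = {a,b}"
      "path_image c2 \<inter> path_image c = {a,b}"
    and out: "path_image c \<inter> inside (path_image c1 \<union> path_image c2) = {}"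
  shows "path_image c2 \<inter> inside (path_image c1 \<union> path_image c) \<noteq> {} \<or>
    path_image c1 \<inter> inside (path_image c2 \<union> path_image c) \<noteq> {}"
proof (rule ccontr)
  assume "\<not> ?thesis"
  then have 2: "path_image c2 \<inter> inside (path_image c1 \<union> path_image c) = {}"
    and 1: "path_image c1 \<inter> inside (path_image c2 \<union> path_image c) = {}" by auto
  let ?J1 = "path_image c1 \<union> path_image c" and ?J2 = "path_image c2 \<union> path_image c"
    and ?J = "path_image c1 \<union> path_image c2"
  note p1 = arcs_simple_closed_path[OF arcs(1,3) ends(1,2,5,6) ints(2)]
  have ints': "path_image c \<inter> path_image c2 = {a,b}" "path_image c \<inter> path_image c1 = {a,b}"
    "path_image c2 \<inter> path_image c1 = {a,b}" using ints by auto
  note p2 = arcs_simple_closed_path[OF arcs(3,2) ends(5,6,3,4) ints'(1)]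
  note p = arcs_simple_closed_path[OF arcs(1,2) ends(1-4) ints(1)]
  obtain z where z: "z \<in> inside ?J1" using arcs_jordan(1)[OF arcs(1,3) ends(1,2,5,6) ints(2)] by blast
  have z': "z \<notin> path_image c1" "z \<notin> path_image c" "z \<notin> path_image c2"
    using inside_no_overlap[of ?J1] 2 z by blast+
  have "z \<notin> inside ?J" using theta_insides_equal[OF arcs ends ints 2 out] z by blast
  then have "z \<in> outside ?J" using z' inside_Un_outside[of ?J] by blast
  then have w: "winding_number (c1 +++ reversepath c2) z = 0"
    using winding_number_zero_in_outside[OF _ p(2)] p simple_path_imp_path by metis
  have "inside (path_image c \<union> path_image c1) \<inter> inside (path_image c \<union> path_image c2) = {}"
    by (rule theta_insides_equal[OF arcs(3,2,1) ends(5,6,3,4,1,2) ints'(1,2) ints'(3)])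
      (use 1 2 in \<open>simp_all add: Un_commute\<close>)
  then have "z \<notin> inside ?J2" using z by (auto simp: Un_commute)
  then have "z \<in> outside ?J2" using z' inside_Un_outside[of ?J2] by blast
  then have w2: "winding_number (c +++ reversepath c2) z = 0"
    using winding_number_zero_in_outside[OF _ p2(2)] p2 simple_path_imp_path by (metis Un_commute)
  have "norm (winding_number (c1 +++ reversepath c) z) = 1"
    using simple_closed_path_norm_winding_number_inside[OF p1(1)] z p1(3) by simp
  then show False using theta_winding[OF arcs ends ints z'(1,3,2)] w w2 by simp
qed

text \<open>By \<open>meet\<close>, \<open>c2\<close> is a chord inside the curve formed by
  \<open>c1\<close> and \<open>c\<close>, where the splitting of an inside applies. Taking
  complements turns that into a splitting of the outside of \<open>c1\<close> and \<open>c2\<close>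
  by \<open>c\<close>.\<close>

lemma theta_split_outside:
  fixes c1 c2 c :: "real \<Rightarrow> complex"
  assumes arcs: "arc c1" "arc c2" "arc c"
    and ends: "pathstart c1 = a" "pathfinish c1 = b" "pathstart c2 = a" "pathfinish c2 = b"
      "pathstart c = a" "pathfinish c = b"
    and ints: "path_image c1 \<inter> path_image c2 = {a,b}" "path_image c1 \<inter> path_image c = {a,b}"
      "path_image c2 \<inter> path_image c = {a,b}"
    and meet: "path_image c2 \<inter> inside (path_image c1 \<union> path_image c) \<noteq> {}"
  shows "outside (path_image c1 \<union> path_image c) \<inter> inside (path_image c2 \<union> path_image c) = {}"
    "outside (path_image c1 \<union> path_image c) \<union> inside (path_image c2 \<union> path_image c) =
      outside (path_image c1 \<union> path_image c2) - path_image c"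
proof -
  let ?J1 = "path_image c1 \<union> path_image c" and ?J2 = "path_image c2 \<union> path_image c"
    and ?J = "path_image c1 \<union> path_image c2"
  have ab: "a \<noteq> b" using arcs(1) ends by (metis arc_distinct_ends)
  have ints': "path_image c \<inter> path_image c2 = {a,b}" using ints by auto
  obtain i: "inside ?J \<inter> inside (path_image c \<union> path_image c2) = {}"
    "inside ?J \<union> inside (path_image c \<union> path_image c2) \<union> (path_image c2 - {a,b}) = inside ?J1"
    using split_inside_simple_closed_curve[OF arc_imp_simple_path[OF arcs(1)] ends(1,2)
        arc_imp_simple_path[OF arcs(3)] ends(5,6) arc_imp_simple_path[OF arcs(2)] ends(3,4) ab ints(2,1) ints' meet]
    by blast
  have i': "inside ?J \<inter> inside ?J2 = {}" "inside ?J \<union> inside ?J2 \<union> (path_image c2 - {a,b}) = inside ?J1"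
    using i by (simp_all add: Un_commute)
  have abc: "a \<in> path_image c1" "b \<in> path_image c1" using ints by auto
  have 1: "x \<in> inside ?J1 \<longleftrightarrow> x \<in> inside ?J \<or> x \<in> inside ?J2 \<or> x \<in> path_image c2 \<and> x \<noteq> a \<and> x \<noteq> b" for x
    using i'(2) by blast
  have 2: "x \<notin> inside ?J2" if "x \<in> inside ?J" for x using i'(1) that by blast
  have 3: "x \<notin> path_image c2" "x \<notin> path_image c" "x \<notin> path_image c1" "x \<notin> inside ?J" if x: "x \<in> inside ?J2" for x
    using inside_not_in[OF x] 2[of x] x inside_not_in[of x ?J1] 1[of x] by auto
  show "outside ?J1 \<inter> inside ?J2 = {}" using 1 outside_iff by blast
  have "x \<in> outside ?J1 \<or> x \<in> inside ?J2 \<longleftrightarrow> x \<in> outside ?J \<and> x \<notin> path_image c" for x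
    using 1[of x] 3[of x] abc unfolding outside_iff by auto
  then show "outside ?J1 \<union> inside ?J2 = outside ?J - path_image c" by blast
qed

text \<open>For an inside this is the splitting by a chord. For an outside,
  \<open>theta_nested\<close> says that one of \<open>c1\<close>, \<open>c2\<close> enters the
  inside of the curve formed by the other two arcs, and this decides which of the two new regions is
  unbounded.\<close>

proposition theta_split:
  fixes c1 c2 c :: "real \<Rightarrow> complex"
  assumes arcs: "arc c1" "arc c2" "arc c"
    and ends: "pathstart c1 = a" "pathfinish c1 = b" "pathstart c2 = a" "pathfinish c2 = b"
      "pathstart c = a" "pathfinish c = b"
    and ints: "path_image c1 \<inter> path_image c2 = {a,b}" "path_image c1 \<inter> path_image c = {a,b}"
      "path_image c2 \<inter> path_image c = {a,b}"
    and D: "D = inside (path_image c1 \<union> path_image c2) \<or> D = outside (path_image c1 \<union> path_image c2)"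
    and sub: "path_image c - {a,b} \<subseteq> D"
  obtains D1 D2 where
    "D1 = inside (path_image c1 \<union> path_image c) \<or> D1 = outside (path_image c1 \<union> path_image c)"
    "D2 = inside (path_image c2 \<union> path_image c) \<or> D2 = outside (path_image c2 \<union> path_image c)"
    "D1 \<inter> D2 = {}" "D1 \<union> D2 = D - path_image c"
proof -
  let ?J1 = "path_image c1 \<union> path_image c" and ?J2 = "path_image c2 \<union> path_image c"
    and ?J = "path_image c1 \<union> path_image c2"
  have ab: "a \<noteq> b" using arcs(1) ends by (metis arc_distinct_ends)
  obtain x where x: "x \<in> path_image c" "x \<noteq> a" "x \<noteq> b" using arc_other_point[OF arcs(3)] ends by metis
  show ?thesis
    using D
  proof
    assume D: "D = inside ?J"
    have "path_image c \<inter> inside ?J \<noteq> {}" using x sub D by blast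
    then obtain i: "inside ?J1 \<inter> inside ?J2 = {}" "inside ?J1 \<union> inside ?J2 \<union> (path_image c - {a,b}) = inside ?J"
      using split_inside_simple_closed_curve[OF arc_imp_simple_path[OF arcs(1)] ends(1,2)
          arc_imp_simple_path[OF arcs(2)] ends(3,4) arc_imp_simple_path[OF arcs(3)] ends(5,6) ab ints]
      by blast
    have "inside ?J1 \<inter> path_image c = {}" "inside ?J2 \<inter> path_image c = {}"
      using inside_no_overlap[of ?J1] inside_no_overlap[of ?J2] by blast+
    moreover have "inside ?J \<inter> {a,b} = {}" using inside_no_overlap[of ?J] ints by blast
    ultimately have "inside ?J1 \<union> inside ?J2 = D - path_image c" using i(2) D ints by blast
    then show ?thesis using that i(1) by blast
  next
    assume D: "D = outside ?J"
    have "inside ?J \<inter> {a,b} = {}" using inside_no_overlap[of ?J] ints by blast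
    then have "path_image c \<inter> inside ?J = {}" using sub D inside_Int_outside[of ?J] by blast
    from theta_nested[OF arcs ends ints this] show ?thesis
    proof
      assume "path_image c2 \<inter> inside ?J1 \<noteq> {}"
      from theta_split_outside[OF arcs ends ints this] show ?thesis using that D by blast
    next
      assume m: "path_image c1 \<inter> inside ?J2 \<noteq> {}"
      have "path_image c2 \<inter> path_image c1 = {a,b}" using ints by blast
      from theta_split_outside[OF arcs(2,1,3) ends(3,4,1,2,5,6) this ints(3,2) m]
      have "outside ?J2 \<inter> inside ?J1 = {}" "outside ?J2 \<union> inside ?J1 = D - path_image c"
        unfolding D by (simp_all add: Un_commute)
      then show ?thesis using that[of "inside ?J1" "outside ?J2"] by blast
    qed
  qed
qed

section \<open>Paths and cycles as vertex lists\<close>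

fun path_edges :: "'a list \<Rightarrow> 'a set set" where
  "path_edges (x # y # xs) = insert {x, y} (path_edges (y # xs))"
| "path_edges _ = {}"

definition cycle_edges :: "'a list \<Rightarrow> 'a set set" where
  "cycle_edges cs = path_edges (cs @ [hd cs])"

lemma path_edges_append: "path_edges (xs @ y # zs) = path_edges (xs @ [y]) \<union> path_edges (y # zs)"
proof (induction xs)
  case Nil then show ?case by simp
next
  case (Cons x xs) then show ?case by (cases xs) auto
qed

lemma path_edges_rev: "path_edges (rev xs) = path_edges xs"
proof (induction xs rule: path_edges.induct)
  case (1 x y xs)
  have "path_edges (rev xs @ y # [x]) = path_edges (rev xs @ [y]) \<union> path_edges [y,x]"
    by (rule path_edges_append)
  then show ?case using 1 by (simp add: insert_commute Un_commute)
qed simp_all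

lemma path_edges_Union_subset: "\<Union> (path_edges xs) \<subseteq> set xs"
  by (induction xs rule: path_edges.induct) auto

lemma path_edges_Union: "length xs \<ge> 2 \<Longrightarrow> \<Union> (path_edges xs) = set xs"
proof (induction xs rule: path_edges.induct)
  case (1 x y xs) then show ?case by (cases xs) auto
qed simp_all

lemma finite_path_edges: "finite (path_edges xs)"
  by (induction xs rule: path_edges.induct) auto

lemma path_edges_card_2: "distinct xs \<Longrightarrow> e \<in> path_edges xs \<Longrightarrow> card e = 2"
  by (induction xs rule: path_edges.induct) auto

lemma card_path_edges: "distinct xs \<Longrightarrow> card (path_edges xs) = length xs - 1"
proof (induction xs rule: path_edges.induct)
  case (1 x y xs)
  have "{x,y} \<notin> path_edges (y # xs)"
    using path_edges_Union_subset[of "y # xs"] 1(2) by auto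
  then show ?case using 1 by (simp add: finite_path_edges)
qed simp_all

lemma path_edges_nth: "path_edges xs = {{xs ! i, xs ! Suc i} | i. Suc i < length xs}"
proof (induction xs rule: path_edges.induct)
  case (1 x y xs)
  have "{{(x#y#xs) ! i, (x#y#xs) ! Suc i} | i. Suc i < length (x#y#xs)} =
    insert {x,y} {{(y#xs) ! i, (y#xs) ! Suc i} | i. Suc i < length (y#xs)}" (is "?L = ?R")
  proof (intro equalityI subsetI)
    fix e assume "e \<in> ?L"
    then obtain i where i: "e = {(x#y#xs) ! i, (x#y#xs) ! Suc i}" "Suc i < length (x#y#xs)" by auto
    then show "e \<in> ?R" by (cases i) auto
  next
    fix e assume "e \<in> ?R"
    then consider "e = {x,y}" | i where "e = {(y#xs) ! i, (y#xs) ! Suc i}" "Suc i < length (y#xs)" by auto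
    then show "e \<in> ?L"
    proof cases
      case 1 then show ?thesis by (auto intro!: exI[of _ 0])
    next
      case 2 then show ?thesis by (auto intro!: exI[of _ "Suc i"])
    qed
  qed
  then show ?case using 1 by simp
qed simp_all

lemma cycle_edges_nth:
  assumes "cs \<noteq> []" "i < length cs"
  shows "{cs ! i, cs ! ((i + 1) mod length cs)} \<in> cycle_edges cs"
proof (cases "Suc i < length cs")
  case True
  then have "{cs ! i, cs ! ((i + 1) mod length cs)} = {(cs @ [hd cs]) ! i, (cs @ [hd cs]) ! Suc i}"
    by (simp add: nth_append)
  then show ?thesis using assms unfolding cycle_edges_def path_edges_nth by (intro CollectI exI[of _ i]) auto
next
  case False
  then have "Suc i = length cs" using assms by simp
  then have "{cs ! i, cs ! ((i + 1) mod length cs)} = {(cs @ [hd cs]) ! i, (cs @ [hd cs]) ! Suc i}"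
    using assms by (simp add: nth_append hd_conv_nth)
  then show ?thesis using assms unfolding cycle_edges_def path_edges_nth by (intro CollectI exI[of _ i]) auto
qed

lemma cycle_edges_rotate: "cycle_edges (xs @ u # ys) = cycle_edges (u # ys @ xs)"
proof (cases xs)
  case (Cons x xs')
  have "cycle_edges (xs @ u # ys) = path_edges ((x # xs') @ u # (ys @ [x]))"
    by (simp add: cycle_edges_def Cons)
  also have "\<dots> = path_edges ((x # xs') @ [u]) \<union> path_edges (u # ys @ [x])"
    by (rule path_edges_append)
  also have "\<dots> = path_edges ((u # ys) @ x # (xs' @ [u]))"
    using path_edges_append[of "u # ys" x "xs' @ [u]"] by auto
  finally show ?thesis by (simp add: cycle_edges_def Cons)
qed simp

text \<open>Both parts are read from \<open>u\<close> to \<open>v\<close>, as theta curves require;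
  hence the reversal of \<open>ys\<close>.\<close>

lemma two_paths_cycle:
  "cycle_edges (u # xs @ v # ys) = path_edges (u # xs @ [v]) \<union> path_edges (u # rev ys @ [v])"
proof -
  have "path_edges (u # rev ys @ [v]) = path_edges (rev (v # ys @ [u]))" by simp
  also have "\<dots> = path_edges (v # ys @ [u])" by (rule path_edges_rev)
  finally show ?thesis
    using path_edges_append[of "u # xs" v "ys @ [u]"] by (simp add: cycle_edges_def)
qed

lemma cycle_split:
  assumes "distinct cs" "u \<in> set cs" "v \<in> set cs" "u \<noteq> v"
  obtains xs ys where "distinct (u # xs @ v # ys)" "set (u # xs @ v # ys) = set cs"
    "length (u # xs @ v # ys) = length cs"
    "cycle_edges cs = path_edges (u # xs @ [v]) \<union> path_edges (u # rev ys @ [v])"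
proof -
  obtain as bs where cs: "cs = as @ u # bs" using assms(2) by (meson split_list)
  then have "v \<in> set (bs @ as)" using assms(3,4) by auto
  then obtain xs ys where b: "bs @ as = xs @ v # ys" by (meson split_list)
  have "cycle_edges cs = cycle_edges (u # xs @ v # ys)"
    unfolding cs cycle_edges_rotate b by simp
  moreover have "distinct (u # bs @ as)" "set (u # bs @ as) = set cs" "length (u # bs @ as) = length cs"
    using assms(1) by (auto simp: cs)
  ultimately show ?thesis using that[of xs ys] by (simp only: b two_paths_cycle)
qed

lemma cycle_edges_Union: "cs \<noteq> [] \<Longrightarrow> \<Union> (cycle_edges cs) = set cs"
  unfolding cycle_edges_def by (subst path_edges_Union) (auto simp: Suc_le_eq)

lemma card_cycle_edges:
  assumes "distinct cs" "length cs \<ge> 3"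
  shows "card (cycle_edges cs) = length cs"
proof -
  obtain x y zs where cs: "cs = x # y # zs" "zs \<noteq> []"
    using assms(2) by (cases cs; cases "tl cs"; cases "tl (tl cs)") auto
  have "cycle_edges cs = insert {x,y} (path_edges (y # zs @ [x]))" by (simp add: cycle_edges_def cs)
  moreover have "{x,y} \<notin> path_edges (y # zs @ [x])"
  proof -
    obtain z ws where z: "zs = z # ws" using cs(2) by (cases zs) auto
    have "y \<notin> \<Union> (path_edges (z # ws @ [x]))"
      using path_edges_Union_subset[of "z # ws @ [x]"] assms(1) cs z by auto
    then show ?thesis using assms(1) cs z by (auto simp: doubleton_eq_iff)
  qed
  moreover have "card (path_edges (y # zs @ [x])) = length zs + 1"
    using card_path_edges[of "y # zs @ [x]"] assms(1) cs by auto
  ultimately show ?thesis using cs by (simp add: finite_path_edges)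
qed

text \<open>A common edge has both ends in \<open>{u,v}\<close>, so it is \<open>{u,v}\<close>; but
  a path with an interior vertex does not use that edge.\<close>

lemma path_edges_disjoint:
  assumes "distinct (u # xs @ [v])" "distinct (u # ys @ [v])" "set xs \<inter> set ys = {}" "xs \<noteq> [] \<or> ys \<noteq> []"
  shows "path_edges (u # xs @ [v]) \<inter> path_edges (u # ys @ [v]) = {}"
proof (rule ccontr)
  have no: "{u,v} \<notin> path_edges (u # zs @ [v])" if zs: "distinct (u # zs @ [v])" "zs \<noteq> []" for zs
  proof -
    obtain z ws where z: "zs = z # ws" using zs(2) by (cases zs) auto
    have "u \<notin> \<Union> (path_edges (z # ws @ [v]))"
      using path_edges_Union_subset[of "z # ws @ [v]"] zs(1) z by auto
    then show ?thesis using zs(1) z by (auto simp: doubleton_eq_iff)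
  qed
  assume "\<not> ?thesis"
  then obtain e where e: "e \<in> path_edges (u # xs @ [v])" "e \<in> path_edges (u # ys @ [v])" by blast
  have "e \<subseteq> {u,v}"
    using path_edges_Union_subset[of "u # xs @ [v]"] path_edges_Union_subset[of "u # ys @ [v]"] e assms(3) by fastforce
  moreover have "card e = 2" using path_edges_card_2 assms(1) e(1) by blast
  moreover have "card {u,v} = 2" using assms(1) by simp
  ultimately have "e = {u,v}" by (simp add: card_subset_eq)
  then show False using no e assms by blast
qed

text \<open>Vertices are prepended one by one; a vertex already on the path cuts it back to that
  vertex, which keeps the list distinct.\<close>

lemma rtrancl_path:
  assumes "(x, y) \<in> {(a, b). {a, b} \<in> F}\<^sup>*"
  obtains xs where "distinct xs" "xs \<noteq> []" "hd xs = x" "last xs = y" "path_edges xs \<subseteq> F"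
  using assms
proof (induction arbitrary: thesis rule: converse_rtrancl_induct)
  case base
  show ?case by (rule base[of "[y]"]) auto
next
  case (step x z)
  obtain xs where xs: "distinct xs" "xs \<noteq> []" "hd xs = z" "last xs = y" "path_edges xs \<subseteq> F"
    using step.IH by blast
  show ?case
  proof (cases "x \<in> set xs")
    case True
    then obtain as bs where ab: "xs = as @ x # bs" by (meson split_list)
    have "path_edges (x # bs) \<subseteq> F" using xs(5) path_edges_append[of as x bs] unfolding ab by blast
    then show ?thesis using step.prems[of "x # bs"] xs ab by auto
  next
    case False
    have "path_edges (x # xs) \<subseteq> F" using xs step.hyps(1) by (cases xs) auto
    then show ?thesis using step.prems[of "x # xs"] xs False by auto
  qed
qed

lemma path_edges_snoc: "m \<noteq> [] \<Longrightarrow> path_edges (m @ [h]) = insert {last m, h} (path_edges m)"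
  by (induction m rule: path_edges.induct) auto

lemma path_edges_Cons: "m \<noteq> [] \<Longrightarrow> path_edges (h # m) = insert {h, hd m} (path_edges m)"
  by (cases m) auto

section \<open>Faces of plane graphs\<close>

text \<open>Serves to place the end points of an ear in the closure of the face that contains its
  interior.\<close>

lemma arc_image_subset_closure:
  fixes c :: "real \<Rightarrow> 'a::euclidean_space"
  assumes "arc c"
  shows "path_image c \<subseteq> closure (path_image c - {pathstart c, pathfinish c})"
proof -
  have "c ` closure {0<..<1} \<subseteq> closure (c ` {0<..<1})"
    using assms by (intro image_closure_subset closure_subset) (auto simp: arc_def path_def)
  then show ?thesis
    unfolding simple_path_endless[OF arc_imp_simple_path[OF assms]] by (simp add: path_image_def)
qed

locale plane_graph =
  fixes V :: "'a set" and E :: "'a set set" and p :: "'a \<Rightarrow> complex" and \<gamma> :: "'a set \<Rightarrow> real \<Rightarrow> complex"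
  assumes finV: "finite V" and sg: "simple_graph V E" and inj: "inj_on p V"
    and arcs: "\<And>e. e \<in> E \<Longrightarrow> arc (\<gamma> e)"
    and ends: "\<And>e. e \<in> E \<Longrightarrow> {pathstart (\<gamma> e), pathfinish (\<gamma> e)} = p ` e"
    and verts: "\<And>e. e \<in> E \<Longrightarrow> path_image (\<gamma> e) \<inter> p ` V = p ` e"
    and cross: "\<And>e e'. e \<in> E \<Longrightarrow> e' \<in> E \<Longrightarrow> e \<noteq> e' \<Longrightarrow>
      path_image (\<gamma> e) \<inter> path_image (\<gamma> e') \<subseteq> p ` (e \<inter> e')"
begin

definition drawing :: "'a set set \<Rightarrow> complex set" where
  "drawing S = (\<Union>e\<in>S. path_image (\<gamma> e))"

lemma finE: "finite E" using simple_graph_finite[OF sg finV] .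

lemma Union_E: "S \<subseteq> E \<Longrightarrow> \<Union> S \<subseteq> V" using sg by (auto simp: simple_graph_iff)

lemma drawing_Un: "drawing (S \<union> T) = drawing S \<union> drawing T"
  by (auto simp: drawing_def)

lemma drawing_mono: "S \<subseteq> T \<Longrightarrow> drawing S \<subseteq> drawing T"
  by (auto simp: drawing_def)

lemma drawing_verts:
  assumes "S \<subseteq> E"
  shows "drawing S \<inter> p ` V = p ` \<Union> S"
proof -
  have "drawing S \<inter> p ` V = (\<Union>e\<in>S. path_image (\<gamma> e) \<inter> p ` V)" by (auto simp: drawing_def)
  also have "\<dots> = (\<Union>e\<in>S. p ` e)" by (rule SUP_cong) (simp_all add: verts subsetD[OF assms])
  finally show ?thesis by auto
qed

lemma vertex_in_drawing: "S \<subseteq> E \<Longrightarrow> v \<in> \<Union> S \<Longrightarrow> p v \<in> drawing S"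
  using drawing_verts by blast

lemma vertex_in_drawing_iff: "S \<subseteq> E \<Longrightarrow> v \<in> V \<Longrightarrow> p v \<in> drawing S \<longleftrightarrow> v \<in> \<Union> S"
  using drawing_verts[of S] Union_E[of S] inj_on_image_mem_iff[OF inj, of v "\<Union> S"] by blast

lemma drawing_Int:
  assumes "S \<subseteq> E" "T \<subseteq> E" "S \<inter> T = {}"
  shows "drawing S \<inter> drawing T \<subseteq> p ` (\<Union> S \<inter> \<Union> T)"
proof
  fix x assume "x \<in> drawing S \<inter> drawing T"
  then obtain e e' where e: "e \<in> S" "e' \<in> T" "x \<in> path_image (\<gamma> e)" "x \<in> path_image (\<gamma> e')"
    by (auto simp: drawing_def)
  then have "x \<in> p ` (e \<inter> e')" using cross[of e e'] assms by blast
  then show "x \<in> p ` (\<Union> S \<inter> \<Union> T)" using e by blast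
qed

text \<open>\<open>planar\<close> fixes the end points of an edge curve only as a set, so the curve
  may have to be reversed.\<close>

lemma edge_arc:
  assumes "{x, y} \<in> E"
  obtains g where "arc g" "pathstart g = p x" "pathfinish g = p y" "path_image g = drawing {{x,y}}"
proof -
  have "{pathstart (\<gamma> {x,y}), pathfinish (\<gamma> {x,y})} = {p x, p y}" using ends[OF assms] by simp
  then consider "pathstart (\<gamma> {x,y}) = p x" "pathfinish (\<gamma> {x,y}) = p y"
    | "pathstart (\<gamma> {x,y}) = p y" "pathfinish (\<gamma> {x,y}) = p x" by (auto simp: doubleton_eq_iff)
  then show ?thesis
  proof cases
    case 1 then show ?thesis using that[of "\<gamma> {x,y}"] arcs[OF assms] by (simp add: drawing_def)
  next
    case 2 then show ?thesis using that[of "reversepath (\<gamma> {x,y})"] arcs[OF assms]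
      by (simp add: drawing_def arc_reversepath)
  qed
qed

lemma path_arc:
  assumes "distinct vs" "length vs \<ge> 2" "path_edges vs \<subseteq> E"
  shows "\<exists>g. arc g \<and> pathstart g = p (hd vs) \<and> pathfinish g = p (last vs) \<and> path_image g = drawing (path_edges vs)"
  using assms
proof (induction vs rule: path_edges.induct)
  case (1 x y xs)
  have xy: "{x,y} \<in> E" using 1(4) by simp
  obtain h where h: "arc h" "pathstart h = p x" "pathfinish h = p y" "path_image h = drawing {{x,y}}"
    using edge_arc[OF xy] .
  show ?case
  proof (cases xs)
    case Nil then show ?thesis using h by auto
  next
    case (Cons z zs)
    then obtain g where g: "arc g" "pathstart g = p y" "pathfinish g = p (last (y # xs))"
      "path_image g = drawing (path_edges (y # xs))" using 1 by auto
    have U: "\<Union> (path_edges (y # xs)) \<subseteq> set (y # xs)" by (rule path_edges_Union_subset)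
    then have "{x,y} \<notin> path_edges (y # xs)" using 1(2) by auto
    then have "path_image h \<inter> path_image g \<subseteq> p ` (\<Union> {{x,y}} \<inter> \<Union> (path_edges (y # xs)))"
      unfolding h(4) g(4) by (intro drawing_Int) (use xy 1(4) in auto)
    also have "\<dots> \<subseteq> {p y}" using U 1(2) by auto
    finally have i: "path_image h \<inter> path_image g \<subseteq> {pathstart g}" using g(2) by simp
    have "arc (h +++ g)" using arc_join[OF h(1) g(1) _ i] h(3) g(2) by simp
    moreover have "path_image (h +++ g) = drawing (path_edges (x # y # xs))"
      using h(3,4) g(2,4) by (simp add: path_image_join drawing_def)
    ultimately show ?thesis using h g by (intro exI[of _ "h +++ g"]) auto
  qed
qed auto

lemma paths_Int:
  assumes "distinct (u # xs @ [v])" "distinct (u # ys @ [v])" "set xs \<inter> set ys = {}"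
    "path_edges (u # xs @ [v]) \<subseteq> E" "path_edges (u # ys @ [v]) \<subseteq> E"
    "path_edges (u # xs @ [v]) \<inter> path_edges (u # ys @ [v]) = {}"
  shows "drawing (path_edges (u # xs @ [v])) \<inter> drawing (path_edges (u # ys @ [v])) = {p u, p v}"
proof -
  have U: "\<Union> (path_edges (u # zs @ [v])) = set (u # zs @ [v])" for zs
    by (rule path_edges_Union) simp
  have "drawing (path_edges (u # xs @ [v])) \<inter> drawing (path_edges (u # ys @ [v])) \<subseteq>
      p ` (set (u # xs @ [v]) \<inter> set (u # ys @ [v]))"
    using drawing_Int[OF assms(4,5,6)] unfolding U .
  also have "set (u # xs @ [v]) \<inter> set (u # ys @ [v]) = {u,v}" using assms(1-3) by auto
  finally show ?thesis
    using vertex_in_drawing[OF assms(4)] vertex_in_drawing[OF assms(5)] unfolding U by auto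
qed

definition is_cycle :: "'a list \<Rightarrow> bool" where
  "is_cycle cs \<longleftrightarrow> distinct cs \<and> length cs \<ge> 3 \<and> cycle_edges cs \<subseteq> E"

lemma cycle_theta:
  assumes "is_cycle cs" "u \<in> set cs" "v \<in> set cs" "u \<noteq> v"
  obtains xs ys where "distinct (u # xs @ v # ys)" "set (u # xs @ v # ys) = set cs"
    "length (u # xs @ v # ys) = length cs" "xs \<noteq> [] \<or> ys \<noteq> []"
    "cycle_edges cs = path_edges (u # xs @ [v]) \<union> path_edges (u # rev ys @ [v])"
    "path_edges (u # xs @ [v]) \<inter> path_edges (u # rev ys @ [v]) = {}"
proof -
  obtain xs ys where c: "distinct (u # xs @ v # ys)" "set (u # xs @ v # ys) = set cs"
    "length (u # xs @ v # ys) = length cs"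
    "cycle_edges cs = path_edges (u # xs @ [v]) \<union> path_edges (u # rev ys @ [v])"
    using cycle_split[of cs u v] assms by (auto simp: is_cycle_def)
  have "length (u # xs @ v # ys) \<ge> 3" using c(3) assms(1) by (simp add: is_cycle_def)
  then have ne: "xs \<noteq> [] \<or> ys \<noteq> []" by (cases xs; cases ys) auto
  have "path_edges (u # xs @ [v]) \<inter> path_edges (u # rev ys @ [v]) = {}"
    by (rule path_edges_disjoint) (use c(1) ne in auto)
  then show ?thesis using that c ne by blast
qed

lemma cycle_arcs:
  assumes "is_cycle cs"
  obtains c1 c2 a b where "arc c1" "arc c2" "pathstart c1 = a" "pathfinish c1 = b"
    "pathstart c2 = a" "pathfinish c2 = b" "path_image c1 \<inter> path_image c2 = {a,b}"
    "path_image c1 \<union> path_image c2 = drawing (cycle_edges cs)"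
proof -
  obtain u v ws where "cs = u # v # ws" "distinct cs"
    using assms unfolding is_cycle_def by (cases cs; cases "tl cs") auto
  then have uv: "u \<in> set cs" "v \<in> set cs" "u \<noteq> v" by auto
  obtain xs ys where c: "distinct (u # xs @ v # ys)"
    "cycle_edges cs = path_edges (u # xs @ [v]) \<union> path_edges (u # rev ys @ [v])"
    "path_edges (u # xs @ [v]) \<inter> path_edges (u # rev ys @ [v]) = {}"
    using cycle_theta[OF assms uv] .
  have E: "path_edges (u # xs @ [v]) \<subseteq> E" "path_edges (u # rev ys @ [v]) \<subseteq> E"
    using c(2) assms by (auto simp: is_cycle_def)
  have d: "distinct (u # xs @ [v])" "distinct (u # rev ys @ [v])" using c(1) by auto
  obtain c1 where c1: "arc c1" "pathstart c1 = p u" "pathfinish c1 = p v"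
    "path_image c1 = drawing (path_edges (u # xs @ [v]))" using path_arc[OF d(1) _ E(1)] by auto
  obtain c2 where c2: "arc c2" "pathstart c2 = p u" "pathfinish c2 = p v"
    "path_image c2 = drawing (path_edges (u # rev ys @ [v]))" using path_arc[OF d(2) _ E(2)] by auto
  have "path_image c1 \<inter> path_image c2 = {p u, p v}"
    unfolding c1(4) c2(4) by (rule paths_Int[OF d _ E c(3)]) (use c(1) in auto)
  moreover have "path_image c1 \<union> path_image c2 = drawing (cycle_edges cs)"
    by (simp add: c1(4) c2(4) c(2) drawing_Un)
  ultimately show ?thesis using that c1 c2 by blast
qed

lemma cycle_jordan:
  assumes "is_cycle cs"
  defines "J \<equiv> drawing (cycle_edges cs)"
  shows "inside J \<noteq> {}" "open (inside J)" "connected (inside J)" "bounded (inside J)" "frontier (inside J) = J"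
    "outside J \<noteq> {}" "open (outside J)" "connected (outside J)" "\<not> bounded (outside J)" "frontier (outside J) = J"
    "bounded J"
proof -
  obtain c1 c2 a b where c: "arc c1" "arc c2" "pathstart c1 = a" "pathfinish c1 = b"
    "pathstart c2 = a" "pathfinish c2 = b" "path_image c1 \<inter> path_image c2 = {a,b}"
    "path_image c1 \<union> path_image c2 = drawing (cycle_edges cs)"
    using cycle_arcs[OF assms(1)] .
  note j = arcs_jordan[OF c(1-7)]
  show "inside J \<noteq> {}" "open (inside J)" "connected (inside J)" "bounded (inside J)" "frontier (inside J) = J"
    "outside J \<noteq> {}" "open (outside J)" "connected (outside J)" "\<not> bounded (outside J)" "frontier (outside J) = J"
    using j unfolding J_def c(8)[symmetric] by simp_all
  show "bounded J"
    unfolding J_def c(8)[symmetric] using c(1,2) by (simp add: bounded_arc_image)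
qed

text \<open>An edge outside \<open>T\<close> meets the drawing of \<open>T\<close> in end points
  only, and an arc has further points.\<close>

lemma edge_not_covered:
  assumes e: "e \<in> E" and T: "T \<subseteq> E" and sub: "path_image (\<gamma> e) \<subseteq> drawing T"
  shows "e \<in> T"
proof (rule ccontr)
  assume "e \<notin> T"
  then have "drawing {e} \<inter> drawing T \<subseteq> p ` (\<Union> {e} \<inter> \<Union> T)" using e T by (intro drawing_Int) auto
  then have "path_image (\<gamma> e) \<subseteq> p ` e" using sub by (auto simp: drawing_def)
  then have "path_image (\<gamma> e) \<subseteq> {pathstart (\<gamma> e), pathfinish (\<gamma> e)}" using ends[OF e] by simp
  then show False using nonempty_simple_path_endless[OF arc_imp_simple_path[OF arcs[OF e]]] by blast
qed

text \<open>Read off from the frontier, hence independent of the vertex list chosen for the boundary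
  cycle.\<close>

definition face_edges :: "complex set \<Rightarrow> 'a set set" where
  "face_edges D = {e\<in>E. path_image (\<gamma> e) \<subseteq> frontier D}"

definition is_face :: "complex set \<Rightarrow> 'a list \<Rightarrow> bool" where
  "is_face D cs \<longleftrightarrow> is_cycle cs \<and>
     (D = inside (drawing (cycle_edges cs)) \<or> D = outside (drawing (cycle_edges cs)))"

lemma is_face_frontier: "is_face D cs \<Longrightarrow> frontier D = drawing (cycle_edges cs)"
  unfolding is_face_def using cycle_jordan(5,10) by blast

lemma is_face_open: "is_face D cs \<Longrightarrow> open D"
  unfolding is_face_def using cycle_jordan(2,7) by blast

lemma is_face_nonempty: "is_face D cs \<Longrightarrow> D \<noteq> {}"
  unfolding is_face_def using cycle_jordan(1,6) by blast

lemma face_edges_eq: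
  assumes "is_face D cs"
  shows "face_edges D = cycle_edges cs"
proof -
  have "cycle_edges cs \<subseteq> E" using assms by (auto simp: is_face_def is_cycle_def)
  then show ?thesis
    unfolding face_edges_def is_face_frontier[OF assms] using edge_not_covered
    by (auto simp: drawing_def)
qed

text \<open>\<open>F\<close> is the set of faces of the drawing of \<open>S\<close>; the cardinality equation is Euler's formula.\<close>

definition faced :: "'a set set \<Rightarrow> complex set set \<Rightarrow> bool" where
  "faced S F \<longleftrightarrow> S \<subseteq> E \<and> card (\<Union> S) \<ge> 3 \<and> finite F \<and> card F + card (\<Union> S) = card S + 2 \<and>
     pairwise disjnt F \<and> \<Union> F = - drawing S \<and>
     (\<forall>D\<in>F. \<exists>cs. cycle_edges cs \<subseteq> S \<and> is_face D cs) \<and>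
     (\<forall>e\<in>S. card {D\<in>F. e \<in> face_edges D} \<le> 2)"

lemma faced_cycle:
  assumes "is_cycle cs"
  shows "\<exists>F. faced (cycle_edges cs) F"
proof
  let ?J = "drawing (cycle_edges cs)"
  have cs: "distinct cs" "length cs \<ge> 3" "cycle_edges cs \<subseteq> E" using assms by (auto simp: is_cycle_def)
  have ne: "cs \<noteq> []" using cs(2) by auto
  note j = cycle_jordan[OF assms]
  have io: "inside ?J \<inter> outside ?J = {}" by (rule inside_Int_outside)
  then have "inside ?J \<noteq> outside ?J" using j(1) by blast
  show "faced (cycle_edges cs) {inside ?J, outside ?J}"
    unfolding faced_def
  proof (intro conjI ballI)
    show "card {inside ?J, outside ?J} + card (\<Union> (cycle_edges cs)) = card (cycle_edges cs) + 2"
      using \<open>inside ?J \<noteq> outside ?J\<close> cs ne by (simp add: cycle_edges_Union card_cycle_edges distinct_card)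
    show "3 \<le> card (\<Union> (cycle_edges cs))" using cs ne by (simp add: cycle_edges_Union distinct_card)
    show "pairwise disjnt {inside ?J, outside ?J}" using io by (simp add: pairwise_insert disjnt_def Int_commute)
    show "\<Union> {inside ?J, outside ?J} = - ?J" using inside_Un_outside by auto
    show "\<exists>cs'. cycle_edges cs' \<subseteq> cycle_edges cs \<and> is_face D cs'" if "D \<in> {inside ?J, outside ?J}" for D
      using that assms by (auto simp: is_face_def)
    show "card {D \<in> {inside ?J, outside ?J}. e \<in> face_edges D} \<le> 2" for e
    proof -
      have "card {D \<in> {inside ?J, outside ?J}. e \<in> face_edges D} \<le> card {inside ?J, outside ?J}"
        by (intro card_mono) auto
      also have "\<dots> \<le> 2" by (simp add: card_insert_if)
      finally show ?thesis .
    qed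
  qed (use cs in auto)
qed

text \<open>The open ear is connected and misses the drawing, so it lies in one face
  \<open>D\<close>; its end points lie on the cycle of \<open>D\<close>, which they cut into
  \<open>Q1\<close> and \<open>Q2\<close>. By \<open>theta_split\<close>, \<open>D\<close> gives way
  to \<open>D1\<close> and \<open>D2\<close>, bounded by \<open>Q1\<close> and \<open>Q2\<close>
  together with the ear. The formula persists: one new face, \<open>length m\<close> new vertices,
  \<open>length m + 1\<close> new edges.\<close>

lemma faced_ear:
  assumes faced: "faced S F" and d: "distinct (u # m @ [v])"
    and uv: "u \<in> \<Union> S" "v \<in> \<Union> S" and m: "set m \<inter> \<Union> S = {}"
    and QE: "path_edges (u # m @ [v]) \<subseteq> E" and QS: "path_edges (u # m @ [v]) \<inter> S = {}"
  shows "\<exists>F'. faced (S \<union> path_edges (u # m @ [v])) F'"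
proof -
  define Q where "Q = path_edges (u # m @ [v])"
  have SE: "S \<subseteq> E" and finF: "finite F" and cardF: "card F + card (\<Union> S) = card S + 2"
    and pw: "pairwise disjnt F" and UF: "\<Union> F = - drawing S"
    and faces: "\<And>D. D \<in> F \<Longrightarrow> \<exists>cs. cycle_edges cs \<subseteq> S \<and> is_face D cs"
    and two: "\<And>e. e \<in> S \<Longrightarrow> card {D\<in>F. e \<in> face_edges D} \<le> 2"
    and c3: "card (\<Union> S) \<ge> 3"
    using faced by (auto simp: faced_def)
  have finS: "finite S" using SE finE finite_subset by blast
  have UQ: "\<Union> Q = set (u # m @ [v])" unfolding Q_def by (rule path_edges_Union) simp
  have uV: "u \<in> V" "v \<in> V" "u \<noteq> v" using uv Union_E[OF SE] d by auto
  obtain c where c: "arc c" "pathstart c = p u" "pathfinish c = p v" "path_image c = drawing Q"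
    using path_arc[OF d _ QE] by (auto simp: Q_def)
  define O' where "O' = path_image c - {p u, p v}"
  have "drawing Q \<inter> drawing S \<subseteq> p ` (\<Union> Q \<inter> \<Union> S)"
    using drawing_Int[OF _ SE] QE QS by (auto simp: Q_def)
  also have "\<Union> Q \<inter> \<Union> S = {u,v}" unfolding UQ using m uv by auto
  finally have O'S: "O' \<inter> drawing S = {}" by (auto simp: O'_def c(4))
  have conO': "connected O'"
    using connected_simple_path_endless[OF arc_imp_simple_path[OF c(1)]] c by (simp add: O'_def)
  have "O' \<noteq> {}" using nonempty_simple_path_endless[OF arc_imp_simple_path[OF c(1)]] c by (simp add: O'_def)
  then obtain x where x: "x \<in> O'" by blast
  then obtain D where D: "D \<in> F" "x \<in> D" using O'S UF by blast
  obtain cs where cs: "cycle_edges cs \<subseteq> S" "is_face D cs" using faces[OF D(1)] by blast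
  have cyc: "is_cycle cs" using cs(2) by (simp add: is_face_def)
  have csE: "cycle_edges cs \<subseteq> E" using cs(1) SE by blast
  have csne: "cs \<noteq> []" using cyc by (auto simp: is_cycle_def)
  have setcs: "set cs \<subseteq> \<Union> S" using cycle_edges_Union[OF csne] cs(1) by blast
  let ?J = "drawing (cycle_edges cs)"
  have O'J: "O' \<inter> ?J = {}" using O'S drawing_mono[OF cs(1)] by blast
  have O'D: "O' \<subseteq> D"
    using cs(2) connected_subset_inside[OF conO' O'J] connected_subset_outside[OF conO' O'J] x D(2)
    unfolding is_face_def by blast
  have DS: "D \<inter> drawing S = {}" using D(1) UF by blast
  have "path_image c \<subseteq> closure O'" using arc_image_subset_closure[OF c(1)] c by (simp add: O'_def)
  then have clos: "path_image c \<subseteq> closure D" using closure_mono[OF O'D] by blast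
  \<comment> \<open>An end point of the ear is in the closure of \<open>D\<close> but, being drawn
    already, not in \<open>D\<close>; so it is a vertex on the frontier.\<close>
  have vertex: "w \<in> set cs" if w: "w \<in> {u,v}" for w
  proof -
    have wS: "p w \<in> drawing S" using vertex_in_drawing[OF SE] uv w by blast
    have "p w \<in> path_image c" using c w by (metis insertE pathfinish_in_path_image pathstart_in_path_image singletonD)
    then have "p w \<in> closure D" using clos by blast
    moreover have "p w \<notin> D" using wS DS by blast
    ultimately have "p w \<in> frontier D" using is_face_open[OF cs(2)] by (simp add: frontier_def interior_open)
    then have "p w \<in> ?J" using is_face_frontier[OF cs(2)] by simp
    then have "w \<in> \<Union> (cycle_edges cs)" using vertex_in_drawing_iff[OF csE] w uV by blast
    then show ?thesis using cycle_edges_Union[OF csne] by simp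
  qed
  obtain xs ys where t: "distinct (u # xs @ v # ys)" "set (u # xs @ v # ys) = set cs"
    "length (u # xs @ v # ys) = length cs" "xs \<noteq> [] \<or> ys \<noteq> []"
    "cycle_edges cs = path_edges (u # xs @ [v]) \<union> path_edges (u # rev ys @ [v])"
    "path_edges (u # xs @ [v]) \<inter> path_edges (u # rev ys @ [v]) = {}"
    using cycle_theta[OF cyc vertex vertex uV(3)] by blast
  define Q1 where "Q1 = path_edges (u # xs @ [v])"
  define Q2 where "Q2 = path_edges (u # rev ys @ [v])"
  have Q12: "cycle_edges cs = Q1 \<union> Q2" "Q1 \<inter> Q2 = {}" using t(5,6) by (simp_all add: Q1_def Q2_def)
  have QS': "Q1 \<subseteq> S" "Q2 \<subseteq> S" "Q1 \<subseteq> E" "Q2 \<subseteq> E" using Q12 cs(1) SE by auto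
  have dis: "distinct (u # xs @ [v])" "distinct (u # rev ys @ [v])" using t(1) by auto
  have mdis: "set xs \<inter> set m = {}" "set ys \<inter> set m = {}" using t(2) setcs m by auto
  obtain c1 where c1: "arc c1" "pathstart c1 = p u" "pathfinish c1 = p v" "path_image c1 = drawing Q1"
    using path_arc[OF dis(1)] QS'(3) by (auto simp: Q1_def)
  obtain c2 where c2: "arc c2" "pathstart c2 = p u" "pathfinish c2 = p v" "path_image c2 = drawing Q2"
    using path_arc[OF dis(2)] QS'(4) by (auto simp: Q2_def)
  have i12: "path_image c1 \<inter> path_image c2 = {p u, p v}"
    unfolding c1(4) c2(4) Q1_def Q2_def
    by (rule paths_Int[OF dis]) (use t QS' in \<open>auto simp: Q1_def Q2_def\<close>)
  have i1: "path_image c1 \<inter> path_image c = {p u, p v}"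
    unfolding c1(4) c(4) Q1_def Q_def
    by (rule paths_Int[OF dis(1) d]) (use mdis QE QS QS' in \<open>auto simp: Q1_def\<close>)
  have i2: "path_image c2 \<inter> path_image c = {p u, p v}"
    unfolding c2(4) c(4) Q2_def Q_def
    by (rule paths_Int[OF dis(2) d]) (use mdis QE QS QS' in \<open>auto simp: Q2_def\<close>)
  have "D = inside (path_image c1 \<union> path_image c2) \<or> D = outside (path_image c1 \<union> path_image c2)"
    using cs(2) by (simp add: is_face_def Q12 drawing_Un c1(4) c2(4))
  then obtain D1 D2 where D12:
    "D1 = inside (path_image c1 \<union> path_image c) \<or> D1 = outside (path_image c1 \<union> path_image c)"
    "D2 = inside (path_image c2 \<union> path_image c) \<or> D2 = outside (path_image c2 \<union> path_image c)"
    "D1 \<inter> D2 = {}" "D1 \<union> D2 = D - path_image c"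
    using theta_split[OF c1(1) c2(1) c(1) c1(2,3) c2(2,3) c(2,3) i12 i1 i2] O'D unfolding O'_def by blast
  \<comment> \<open>Of two paths with no common edge, only one can be the single edge
    \<open>{u,v}\<close>; so each new cycle has at least three vertices.\<close>
  have no_edge: "{u,v} \<in> path_edges (u # zs @ [v])" if "zs = []" for zs using that by simp
  have ne1: "xs \<noteq> [] \<or> m \<noteq> []" and ne2: "ys \<noteq> [] \<or> m \<noteq> []"
    using no_edge[of xs] no_edge[of "rev ys"] no_edge[of m] QS QS' by (auto simp: Q1_def Q2_def)
  define C1 where "C1 = u # xs @ v # rev m"
  define C2 where "C2 = u # rev ys @ v # rev m"
  have ce: "cycle_edges C1 = Q1 \<union> Q" "cycle_edges C2 = Q2 \<union> Q"
    using two_paths_cycle[of u xs v "rev m"] two_paths_cycle[of u "rev ys" v "rev m"]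
    by (simp_all add: C1_def C2_def Q1_def Q2_def Q_def)
  have "distinct C1" "distinct C2" using t(1) d mdis by (auto simp: C1_def C2_def)
  moreover have "length C1 \<ge> 3" "length C2 \<ge> 3"
    using ne1 ne2 by (auto simp: C1_def C2_def Suc_le_eq)
  ultimately have cyc12: "is_cycle C1" "is_cycle C2"
    using ce QS' QE by (auto simp: is_cycle_def Q_def)
  have f1: "is_face D1 C1" and f2: "is_face D2 C2"
    using D12(1,2) cyc12 by (simp_all add: is_face_def ce drawing_Un c1(4) c2(4) c(4))
  have fe: "face_edges D1 = Q1 \<union> Q" "face_edges D2 = Q2 \<union> Q" "face_edges D = Q1 \<union> Q2"
    using face_edges_eq[OF f1] face_edges_eq[OF f2] face_edges_eq[OF cs(2)] ce Q12 by simp_all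
  define F' where "F' = insert D1 (insert D2 (F - {D}))"
  have sub: "D1 \<subseteq> D" "D2 \<subseteq> D" using D12(4) by blast+
  have ne: "D1 \<noteq> {}" "D2 \<noteq> {}" using is_face_nonempty f1 f2 by blast+
  have other: "D \<inter> D'' = {}" if "D'' \<in> F - {D}" for D''
    using pw D(1) that by (auto simp: pairwise_def disjnt_def)
  have notin: "D1 \<notin> F - {D}" "D2 \<notin> F - {D}" "D1 \<noteq> D2"
    using other sub ne D12(3) by blast+
  have cF': "card F' = card F + 1"
  proof -
    have "card F > 0" using D(1) finF by (auto simp: card_gt_0_iff)
    then show ?thesis using notin finF D(1) by (simp add: F'_def card_Diff_singleton)
  qed
  have QS'': "Q \<inter> S = {}" using QS by (simp add: Q_def)
  have finQ: "finite Q" by (simp add: Q_def finite_path_edges)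
  have "card (S \<union> Q) = card S + length m + 1"
    using finS finQ QS'' card_path_edges[OF d] by (subst card_Un_disjoint) (auto simp: Q_def)
  moreover have "\<Union> (S \<union> Q) = \<Union> S \<union> set m" using UQ uv by auto
  moreover have finUS: "finite (\<Union> S)" by (rule finite_subset[OF Union_E[OF SE] finV])
  have "card (\<Union> S \<union> set m) = card (\<Union> S) + length m"
    using finUS m d by (subst card_Un_disjoint) (auto simp: distinct_card)
  ultimately have card': "card F' + card (\<Union> (S \<union> Q)) = card (S \<union> Q) + 2" "card (\<Union> (S \<union> Q)) \<ge> 3"
    using cF' cardF c3 by simp_all
  have pw': "pairwise disjnt F'"
  proof -
    have "pairwise disjnt (F - {D})" using pw by (rule pairwise_subset) blast
    moreover have "disjnt D' D''" "disjnt D'' D'" if "D'' \<in> F - {D}" "D' \<in> {D1,D2}" for D' D''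
      using other[OF that(1)] sub that(2) by (auto simp: disjnt_def)
    ultimately show ?thesis using D12(3) by (auto simp: F'_def pairwise_insert disjnt_def)
  qed
  have U': "\<Union> F' = - drawing (S \<union> Q)"
  proof -
    have "D'' \<inter> drawing Q = {}" if "D'' \<in> F - {D}" for D''
    proof -
      have "D'' \<inter> drawing S = {}" using that UF by blast
      then have "p u \<notin> D''" "p v \<notin> D''" using vertex_in_drawing[OF SE] uv by blast+
      moreover have "D'' \<inter> O' = {}" using other[OF that] O'D by blast
      ultimately show ?thesis by (auto simp: O'_def c(4))
    qed
    then have "\<Union> (F - {D}) \<inter> drawing Q = {}" by blast
    moreover have "\<Union> F = D \<union> \<Union> (F - {D})" using D(1) by blast
    moreover have "\<Union> F' = (D - drawing Q) \<union> \<Union> (F - {D})" using D12(4) c(4) by (auto simp: F'_def)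
    ultimately show ?thesis using UF by (auto simp: drawing_Un)
  qed
  have faces': "\<exists>cs. cycle_edges cs \<subseteq> S \<union> Q \<and> is_face D' cs" if D': "D' \<in> F'" for D'
  proof -
    consider "D' = D1" | "D' = D2" | "D' \<in> F" using D' by (auto simp: F'_def)
    then show ?thesis
    proof cases
      case 1 then show ?thesis using f1 ce QS' by (intro exI[of _ C1]) auto
    next
      case 2 then show ?thesis using f2 ce QS' by (intro exI[of _ C2]) auto
    next
      case 3 then show ?thesis using faces by blast
    qed
  qed
  have two': "card {D'\<in>F'. e \<in> face_edges D'} \<le> 2" if e: "e \<in> S \<union> Q" for e
  proof (cases "e \<in> Q")
    case True
    \<comment> \<open>Old faces are bounded by cycles in \<open>S\<close>, so an edge of the ear
      borders only \<open>D1\<close> and \<open>D2\<close>.\<close>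
    have "e \<notin> face_edges D''" if "D'' \<in> F" for D''
      using faces[OF that] face_edges_eq True QS'' by blast
    then have "{D'\<in>F'. e \<in> face_edges D'} \<subseteq> {D1,D2}" by (auto simp: F'_def)
    then have "card {D'\<in>F'. e \<in> face_edges D'} \<le> card {D1,D2}" by (intro card_mono) auto
    then show ?thesis using notin by simp
  next
    case False
    let ?A = "{D'\<in>F. e \<in> face_edges D'}"
    have A2: "card ?A \<le> 2" using two e False by blast
    have finA: "finite ?A" using finF by simp
    \<comment> \<open>An edge of the cycle of \<open>D\<close> loses \<open>D\<close> and gains only
      one of \<open>D1\<close>, \<open>D2\<close>, here called \<open>X\<close>.\<close>
    have *: "card {D'\<in>F'. e \<in> face_edges D'} \<le> 2"
      if "e \<in> Q1 \<union> Q2" "{D'\<in>F'. e \<in> face_edges D'} \<subseteq> insert X (?A - {D})" for X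
    proof -
      have "D \<in> ?A" using that(1) fe(3) D(1) by simp
      then have "card (insert X (?A - {D})) \<le> card ?A"
        using finA card_Suc_Diff1[of ?A D] by (simp add: card_insert_if)
      then show ?thesis using A2 card_mono[OF _ that(2)] finA by auto
    qed
    show ?thesis
    proof (cases "e \<in> Q1 \<union> Q2")
      case True
      show ?thesis
      proof (cases "e \<in> Q1")
        case True
        then have "{D'\<in>F'. e \<in> face_edges D'} \<subseteq> insert D1 (?A - {D})"
          using fe(2) Q12(2) False by (auto simp: F'_def)
        then show ?thesis using * \<open>e \<in> Q1 \<union> Q2\<close> by blast
      next
        case nQ1: False
        then have "{D'\<in>F'. e \<in> face_edges D'} \<subseteq> insert D2 (?A - {D})"
          using fe(1) False by (auto simp: F'_def)
        then show ?thesis using * \<open>e \<in> Q1 \<union> Q2\<close> by blast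
      qed
    next
      case n: False
      then have "{D'\<in>F'. e \<in> face_edges D'} \<subseteq> ?A" using fe(1,2) False by (auto simp: F'_def)
      then have "card {D'\<in>F'. e \<in> face_edges D'} \<le> card ?A" by (rule card_mono[OF finA])
      then show ?thesis using A2 by (rule order_trans)
    qed
  qed
  have "faced (S \<union> Q) F'"
    unfolding faced_def using SE QE finF card' pw' U' faces' two' by (auto simp: F'_def Q_def)
  then show ?thesis unfolding Q_def by blast
qed

end

section \<open>Ears and Euler's formula for 2-connected plane graphs\<close>

lemma rtrancl_edges_sym: "(x, y) \<in> {(a, b). {a, b} \<in> F}\<^sup>* \<Longrightarrow> (y, x) \<in> {(a, b). {a, b} \<in> F}\<^sup>*"
  using sym_rtrancl[of "{(a, b). {a, b} \<in> F}"] by (auto simp: sym_def insert_commute)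

text \<open>\<open>second_neighbour\<close> expresses minimum degree 2, since \<open>u\<close> is
  arbitrary; \<open>no_separation\<close> excludes disconnected graphs and cut vertices.\<close>

locale plane_2connected = plane_graph V E p \<gamma>
  for V :: "'a set" and E :: "'a set set" and p :: "'a \<Rightarrow> complex" and \<gamma> :: "'a set \<Rightarrow> real \<Rightarrow> complex" +
  assumes nonempty: "V \<noteq> {}"
    and second_neighbour: "\<And>v u. v \<in> V \<Longrightarrow> \<exists>w. w \<noteq> u \<and> {v, w} \<in> E"
    and no_separation: "\<And>A B. A \<union> B = V \<Longrightarrow> A \<noteq> V \<Longrightarrow> B \<noteq> V \<Longrightarrow> card (A \<inter> B) \<le> 1 \<Longrightarrow>
      \<exists>e\<in>E. \<not> e \<subseteq> A \<and> \<not> e \<subseteq> B"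
begin

lemma edge_V: "{u, v} \<in> E \<Longrightarrow> u \<in> V \<and> v \<in> V \<and> u \<noteq> v"
  using sg by (auto simp: simple_graph_iff)

lemma edgeE:
  assumes "e \<in> E"
  obtains s t where "e = {s, t}" "s \<in> V" "t \<in> V" "s \<noteq> t"
  using assms sg unfolding simple_graph_def by blast

text \<open>No edge \<open>{u,v}\<close> is a bridge: if \<open>v\<close> were not reachable from
  \<open>u\<close> without it, the set \<open>A\<close> of reachable vertices would be separated
  from the rest by \<open>v\<close> alone. A path avoiding the edge then closes to a cycle.\<close>

lemma ex_cycle: "\<exists>cs. is_cycle cs"
proof -
  obtain u where "u \<in> V" using nonempty by blast
  then obtain v where uv: "{u,v} \<in> E" using second_neighbour by blast
  note uvV = edge_V[OF uv]
  define F where "F = E - {{u,v}}"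
  define A where "A = {y. (u,y) \<in> {(a,b). {a,b} \<in> F}\<^sup>*}"
  have step: "t \<in> A" if "s \<in> A" "{s,t} \<in> F" for s t
    using that unfolding A_def by (auto intro: rtrancl_into_rtrancl)
  have AV: "A \<subseteq> V"
  proof
    fix y assume "y \<in> A"
    then have "(u,y) \<in> {(a,b). {a,b} \<in> F}\<^sup>*" by (simp add: A_def)
    then show "y \<in> V" by (induction rule: rtrancl_induct) (use uvV edge_V in \<open>auto simp: F_def\<close>)
  qed
  have uA: "u \<in> A" by (simp add: A_def)
  have "v \<in> A"
  proof (rule ccontr)
    assume v: "v \<notin> A"
    \<comment> \<open>A second neighbour of \<open>v\<close> lies beyond \<open>v\<close>, so
      \<open>insert v A\<close> is not everything.\<close>
    obtain w where w: "w \<noteq> u" "{v,w} \<in> E" using second_neighbour uvV by blast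
    have "w \<noteq> v" "w \<in> V" using edge_V[OF w(2)] by auto
    have wF: "{w,v} \<in> F" using w uvV by (auto simp: F_def insert_commute doubleton_eq_iff)
    have "insert v A \<union> (V - A) = V" using AV uvV by blast
    moreover have "insert v A \<noteq> V" using step[OF _ wF] v \<open>w \<noteq> v\<close> \<open>w \<in> V\<close> by blast
    moreover have "V - A \<noteq> V" using uA AV by blast
    moreover have "insert v A \<inter> (V - A) = {v}" using uvV v by blast
    ultimately obtain e where e: "e \<in> E" "\<not> e \<subseteq> insert v A" "\<not> e \<subseteq> V - A"
      using no_separation[of "insert v A" "V - A"] by auto
    then obtain s t where st: "e = {s,t}" "s \<in> V" "t \<in> V" using edgeE by metis
    have eF: "{s,t} \<in> F" "{t,s} \<in> F" using e uA st by (auto simp: F_def insert_commute)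
    have "s \<in> A \<longleftrightarrow> t \<in> A" using step[OF _ eF(1)] step[OF _ eF(2)] by blast
    then show False using e(2,3) st by auto
  qed
  then have "(u,v) \<in> {(a,b). {a,b} \<in> F}\<^sup>*" by (simp add: A_def)
  then obtain xs where xs: "distinct xs" "xs \<noteq> []" "hd xs = u" "last xs = v" "path_edges xs \<subseteq> F"
    by (rule rtrancl_path)
  have "cycle_edges xs = insert {v,u} (path_edges xs)"
    unfolding cycle_edges_def using path_edges_snoc[OF xs(2), of "hd xs"] xs by simp
  then have "cycle_edges xs \<subseteq> E" using xs(5) uv by (auto simp: F_def insert_commute)
  moreover have "length xs \<ge> 3"
  proof (rule ccontr)
    assume "\<not> length xs \<ge> 3"
    moreover obtain a ys where a: "xs = a # ys" using xs(2) by (cases xs) auto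
    moreover have "ys \<noteq> []" using xs(3,4) a uvV by auto
    then obtain b zs where "ys = b # zs" by (cases ys) auto
    ultimately have "xs = [u,v]" using xs(3,4) by (cases zs) auto
    then show False using xs(5) by (auto simp: F_def)
  qed
  ultimately show ?thesis using xs(1) by (auto simp: is_cycle_def)
qed

text \<open>A missing edge with both ends in the drawn part is an ear. Otherwise let
  \<open>A\<close> be the component, off the drawn vertices \<open>U\<close>, of an undrawn vertex.
  Its neighbours \<open>N\<close> in \<open>U\<close> separate it from the rest of the graph, so
  there are two of them, and a path through \<open>A\<close> joins them.\<close>

lemma ex_ear:
  assumes S: "S \<subset> E" and c3: "card (\<Union> S) \<ge> 3"
  obtains u m v where "distinct (u # m @ [v])" "u \<in> \<Union> S" "v \<in> \<Union> S" "set m \<inter> \<Union> S = {}"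
    "path_edges (u # m @ [v]) \<subseteq> E" "path_edges (u # m @ [v]) \<inter> S = {}"
proof (cases "\<exists>e\<in>E - S. e \<subseteq> \<Union> S")
  case True
  then obtain e where e: "e \<in> E" "e \<notin> S" "e \<subseteq> \<Union> S" by blast
  obtain u v where uv: "e = {u,v}" "u \<noteq> v" using edgeE[OF e(1)] by metis
  show ?thesis by (rule that[of u "[]" v]) (use e uv in auto)
next
  case False
  define U where "U = \<Union> S"
  obtain e where "e \<in> E" "e \<notin> S" using S by blast
  then obtain x where x: "x \<in> V" "x \<notin> U" using False edgeE U_def by (metis DiffI empty_subsetI insert_subset)
  have UV: "U \<subseteq> V" using Union_E S unfolding U_def by blast
  define F where "F = {e\<in>E. e \<inter> U = {}}"
  define A where "A = {y. (x,y) \<in> {(a,b). {a,b} \<in> F}\<^sup>*}"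
  have step: "t \<in> A" if "s \<in> A" "{s,t} \<in> F" for s t
    using that unfolding A_def by (auto intro: rtrancl_into_rtrancl)
  have AV: "A \<subseteq> V - U"
  proof
    fix y assume "y \<in> A"
    then have "(x,y) \<in> {(a,b). {a,b} \<in> F}\<^sup>*" by (simp add: A_def)
    then show "y \<in> V - U" by (induction rule: rtrancl_induct) (use x edge_V in \<open>auto simp: F_def\<close>)
  qed
  have xA: "x \<in> A" by (simp add: A_def)
  define N where "N = {h\<in>U. \<exists>y\<in>A. {y,h} \<in> E}"
  have finU: "finite U" using UV finV finite_subset by blast
  have "card N \<ge> 2"
  proof (rule ccontr)
    assume "\<not> card N \<ge> 2"
    then have N1: "card N \<le> 1" by simp
    have "(A \<union> N) \<union> (V - A) = V" using AV UV by (auto simp: N_def)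
    moreover have "A \<union> N \<noteq> V"
    proof
      assume "A \<union> N = V"
      then have "U \<subseteq> N" using UV AV by blast
      then have "card U \<le> card N" using finU by (intro card_mono) (auto simp: N_def)
      then show False using N1 c3 by (simp add: U_def)
    qed
    moreover have "V - A \<noteq> V" using xA x by blast
    moreover have "(A \<union> N) \<inter> (V - A) = N" using AV UV by (auto simp: N_def)
    ultimately obtain e where e: "e \<in> E" "\<not> e \<subseteq> A \<union> N" "\<not> e \<subseteq> V - A"
      using no_separation[of "A \<union> N" "V - A"] N1 by auto
    obtain s t where st: "e = {s,t}" "s \<in> V" "t \<in> V" using edgeE[OF e(1)] by metis
    have E2: "{s,t} \<in> E" "{t,s} \<in> E" using e(1) st by (auto simp: insert_commute)
    have *: "b \<in> A \<union> N" if "a \<in> A" "{a,b} \<in> E" "b \<in> V" for a b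
    proof (cases "b \<in> U")
      case True then show ?thesis using that by (auto simp: N_def)
    next
      case False
      then have "{a,b} \<in> F" using that AV by (auto simp: F_def)
      then show ?thesis using step that(1) by blast
    qed
    show False using *[OF _ E2(1)] *[OF _ E2(2)] st e(2,3) by auto
  qed
  then obtain T where "T \<subseteq> N" "card T = 2" by (rule obtain_subset_with_card_n)
  then obtain h h' where hh: "h \<in> N" "h' \<in> N" "h \<noteq> h'" by (auto simp: card_2_iff)
  then obtain y y' where y: "y \<in> A" "{y,h} \<in> E" "y' \<in> A" "{y',h'} \<in> E" "h \<in> U" "h' \<in> U" by (auto simp: N_def)
  have "(y,y') \<in> {(a,b). {a,b} \<in> F}\<^sup>*"
    using y(1,3) rtrancl_edges_sym[of x y F] unfolding A_def by (auto intro: rtrancl_trans)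
  then obtain m where m: "distinct m" "m \<noteq> []" "hd m = y" "last m = y'" "path_edges m \<subseteq> F" by (rule rtrancl_path)
  have mU: "set m \<inter> U = {}"
  proof (cases "length m \<ge> 2")
    case True
    have "set m = \<Union> (path_edges m)" using path_edges_Union[OF True] by simp
    then show ?thesis using m(5) by (auto simp: F_def)
  next
    case False
    then have "m = [y]" using m(2,3) by (cases m; cases "tl m") auto
    then show ?thesis using y(1) AV by auto
  qed
  have pe: "path_edges (h # m @ [h']) = insert {h,y} (insert {y',h'} (path_edges m))"
    using m by (simp add: path_edges_Cons path_edges_snoc)
  show ?thesis
  proof (rule that[of h m h'])
    show "distinct (h # m @ [h'])" using m(1) mU y hh by auto
    show "h \<in> \<Union> S" "h' \<in> \<Union> S" "set m \<inter> \<Union> S = {}" using y mU by (auto simp: U_def)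
    show "path_edges (h # m @ [h']) \<subseteq> E" unfolding pe using y m(5) by (auto simp: F_def insert_commute)
    have "e \<notin> S" if e: "e \<in> path_edges (h # m @ [h'])" for e
    proof
      assume "e \<in> S"
      then have eU: "e \<subseteq> U" "e \<noteq> {}" using S edgeE unfolding U_def by blast+
      have "y \<notin> U" "y' \<notin> U" using y AV by auto
      then show False using e eU m(5) unfolding pe by (auto simp: F_def)
    qed
    then show "path_edges (h # m @ [h']) \<inter> S = {}" by blast
  qed
qed

text \<open>A largest edge set that admits faces leaves no room for an ear.\<close>

lemma ex_faced: "\<exists>F. faced E F"
proof -
  define P where "P S = (\<exists>F. faced S F)" for S
  have finP: "finite {S. P S}"
    by (rule finite_subset[of _ "Pow E"]) (use finE in \<open>auto simp: P_def faced_def\<close>)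
  obtain cs where "is_cycle cs" using ex_cycle by blast
  then have "P (cycle_edges cs)" using faced_cycle by (simp add: P_def)
  then have "Max (card ` {S. P S}) \<in> card ` {S. P S}" using finP by (intro Max_in) auto
  then obtain S where S: "P S" "card S = Max (card ` {S. P S})" by auto
  have max: "card T \<le> card S" if "P T" for T unfolding S(2) using finP that by (intro Max_ge) auto
  obtain F where F: "faced S F" using S(1) by (auto simp: P_def)
  have SE: "S \<subseteq> E" "card (\<Union> S) \<ge> 3" using F by (auto simp: faced_def)
  have "S = E"
  proof (rule ccontr)
    assume "S \<noteq> E"
    then have "S \<subset> E" using SE by blast
    then obtain u m v where e: "distinct (u # m @ [v])" "u \<in> \<Union> S" "v \<in> \<Union> S" "set m \<inter> \<Union> S = {}"
      "path_edges (u # m @ [v]) \<subseteq> E" "path_edges (u # m @ [v]) \<inter> S = {}"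
      using ex_ear SE(2) by blast
    let ?Q = "path_edges (u # m @ [v])"
    have "P (S \<union> ?Q)" using faced_ear[OF F e] by (simp add: P_def)
    then have "card (S \<union> ?Q) \<le> card S" by (rule max)
    moreover have "card (S \<union> ?Q) = card S + card ?Q"
      using e(6) SE(1) finE by (intro card_Un_disjoint) (auto intro: finite_subset finite_path_edges)
    moreover have "card ?Q = length m + 1" using card_path_edges[OF e(1)] by simp
    ultimately show False by simp
  qed
  then show ?thesis using F by blast
qed

text \<open>Only bounded faces are kept: these are determined by their boundaries, so counting boundary
  cycles counts faces.\<close>

theorem bounded_face_cycles:
  obtains C where "finite C" "card E + 1 \<le> card C + card V"
    "\<And>c. c \<in> C \<Longrightarrow> \<exists>cs. is_cycle cs \<and> c = cycle_edges cs"
    "\<And>e. e \<in> E \<Longrightarrow> card {c\<in>C. e \<in> c} \<le> 2"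
proof -
  obtain F where "faced E F" using ex_faced by blast
  then have finF: "finite F" and cardF: "card F + card (\<Union> E) = card E + 2"
    and pw: "pairwise disjnt F" and faces: "\<And>D. D \<in> F \<Longrightarrow> \<exists>cs. is_face D cs"
    and two: "\<And>e. e \<in> E \<Longrightarrow> card {D\<in>F. e \<in> face_edges D} \<le> 2"
    by (auto simp: faced_def)
  have "\<Union> E = V"
  proof
    show "V \<subseteq> \<Union> E" using second_neighbour by blast
  qed (use Union_E in blast)
  define B where "B = {D\<in>F. bounded D}"
  have inside: "D = inside (drawing (face_edges D))" if D: "D \<in> B" for D
  proof -
    obtain cs where cs: "is_face D cs" using faces D by (auto simp: B_def)
    have "bounded D" using D by (simp add: B_def)
    then show ?thesis using cs cycle_jordan(9)[of cs] unfolding face_edges_eq[OF cs] by (auto simp: is_face_def)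
  qed
  \<comment> \<open>The complement of an unbounded face is bounded and contains all other faces, so
    at most one face is unbounded. Dropping it turns the 2 of Euler's formula into the 1 of the
    conclusion.\<close>
  have compl: "bounded (- D)" if D: "D \<in> F - B" for D
  proof -
    obtain cs where cs: "is_face D cs" using faces D by (auto simp: B_def)
    let ?J = "drawing (cycle_edges cs)"
    have cyc: "is_cycle cs" using cs by (simp add: is_face_def)
    have "\<not> bounded D" using D by (auto simp: B_def)
    then have "D = outside ?J" using cs cycle_jordan(4)[OF cyc] by (auto simp: is_face_def)
    then have "- D \<subseteq> ?J \<union> inside ?J" using inside_Un_outside[of ?J] by blast
    moreover have "bounded (?J \<union> inside ?J)" using cycle_jordan(4,11)[OF cyc] by simp
    ultimately show ?thesis by (rule bounded_subset[rotated])
  qed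
  have "D = D'" if D: "D \<in> F - B" "D' \<in> F - B" for D D'
  proof (rule ccontr)
    assume "D \<noteq> D'"
    then have "D' \<subseteq> - D" using pw D by (auto simp: pairwise_def disjnt_def)
    then have "bounded D'" using compl[OF D(1)] bounded_subset by blast
    then show False using D(2) by (simp add: B_def)
  qed
  then have "card (F - B) \<le> 1" using finF by (auto simp: card_le_Suc0_iff_eq)
  moreover have "card (F - B) = card F - card B" using finF by (intro card_Diff_subset) (auto simp: B_def)
  ultimately have cB: "card F \<le> card B + 1" by simp
  have inj: "inj_on face_edges B" using inside by (intro inj_onI) metis
  have finB: "finite B" using finF by (simp add: B_def)
  show ?thesis
  proof (rule that[of "face_edges ` B"])
    show "finite (face_edges ` B)" using finB by simp
    show "card E + 1 \<le> card (face_edges ` B) + card V"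
      using card_image[OF inj] cB cardF \<open>\<Union> E = V\<close> by simp
    show "\<exists>cs. is_cycle cs \<and> c = cycle_edges cs" if c: "c \<in> face_edges ` B" for c
    proof -
      obtain D where D: "D \<in> F" "c = face_edges D" using c by (auto simp: B_def)
      then obtain cs where "is_face D cs" using faces by blast
      then show ?thesis using D(2) face_edges_eq by (intro exI[of _ cs]) (simp add: is_face_def)
    qed
    show "card {c \<in> face_edges ` B. e \<in> c} \<le> 2" if "e \<in> E" for e
    proof -
      have "{c \<in> face_edges ` B. e \<in> c} \<subseteq> face_edges ` {D\<in>F. e \<in> face_edges D}" by (auto simp: B_def)
      then have "card {c \<in> face_edges ` B. e \<in> c} \<le> card {D\<in>F. e \<in> face_edges D}"
        using finF by (intro order_trans[OF card_mono card_image_le]) auto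
      then show ?thesis using two[OF that] by simp
    qed
  qed
qed

end

section \<open>Counting faces\<close>

lemma has_cycle_of_length_mono:
  assumes "has_cycle_of_length W F k" "W \<subseteq> V" "F \<subseteq> E"
  shows "has_cycle_of_length V E k"
proof -
  obtain vs where "length vs = k" "distinct vs" "set vs \<subseteq> W" "\<forall>i<k. {vs ! i, vs ! ((i + 1) mod k)} \<in> F"
    using assms(1) by (auto simp: has_cycle_of_length_def)
  then show ?thesis
    unfolding has_cycle_of_length_def using assms(2,3) by (intro exI[of _ vs]) auto
qed

lemma cycle_has_cycle_of_length:
  assumes "simple_graph V E" "distinct cs" "cs \<noteq> []" "cycle_edges cs \<subseteq> E"
  shows "has_cycle_of_length V E (length cs)"
  unfolding has_cycle_of_length_def
proof (intro exI[of _ cs] conjI allI impI)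
  have "set cs = \<Union> (cycle_edges cs)" using cycle_edges_Union[OF assms(3)] by simp
  also have "\<dots> \<subseteq> V" using assms(1,4) by (auto simp: simple_graph_iff)
  finally show "set cs \<subseteq> V" .
  show "{cs ! i, cs ! ((i + 1) mod length cs)} \<in> E" if "i < length cs" for i
    using cycle_edges_nth[OF assms(3) that] assms(4) by blast
qed (use assms in auto)

definition is_triangle :: "'a set set \<Rightarrow> bool" where
  "is_triangle c \<longleftrightarrow> (\<exists>x y z. distinct [x, y, z] \<and> c = {{x, y}, {y, z}, {z, x}})"

lemma triangle_cycle:
  assumes "distinct cs" "length cs = 3"
  shows "is_triangle (cycle_edges cs)"
proof -
  obtain x y z where "cs = [x,y,z]" using assms(2) by (auto simp: numeral_3_eq_3 length_Suc_conv)
  then show ?thesis using assms(1) unfolding is_triangle_def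
    by (intro exI[of _ x] exI[of _ y] exI[of _ z]) (simp add: cycle_edges_def)
qed

lemma triangle_apex:
  assumes "is_triangle c" "{a, b} \<in> c"
  obtains d where "distinct [a, b, d]" "c = {{a, b}, {a, d}, {b, d}}"
proof -
  obtain x y z where xyz: "distinct [x, y, z]" "c = {{x, y}, {y, z}, {z, x}}"
    using assms(1) by (auto simp: is_triangle_def)
  then consider "a = x" "b = y" | "a = y" "b = x" | "a = y" "b = z" | "a = z" "b = y" | "a = z" "b = x" | "a = x" "b = z"
    using assms(2) by (auto simp: doubleton_eq_iff)
  then show ?thesis
  proof cases
    case 1 show ?thesis by (rule that[of z]) (use 1 xyz in \<open>auto simp: insert_commute\<close>)
  next
    case 2 show ?thesis by (rule that[of z]) (use 2 xyz in \<open>auto simp: insert_commute\<close>)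
  next
    case 3 show ?thesis by (rule that[of x]) (use 3 xyz in \<open>auto simp: insert_commute\<close>)
  next
    case 4 show ?thesis by (rule that[of x]) (use 4 xyz in \<open>auto simp: insert_commute\<close>)
  next
    case 5 show ?thesis by (rule that[of y]) (use 5 xyz in \<open>auto simp: insert_commute\<close>)
  next
    case 6 show ?thesis by (rule that[of y]) (use 6 xyz in \<open>auto simp: insert_commute\<close>)
  qed
qed

text \<open>Two triangles on the edge \<open>{a,b}\<close> with apices \<open>d\<close> and
  \<open>d'\<close> contain the 4-cycle \<open>a\<close>, \<open>d\<close>, \<open>b\<close>,
  \<open>d'\<close>.\<close>

lemma triangles_edge_disjoint:
  assumes sg: "simple_graph V E" and no4: "\<not> has_cycle_of_length V E 4"
    and c: "is_triangle c" "c \<subseteq> E" and c': "is_triangle c'" "c' \<subseteq> E" and ne: "c \<noteq> c'"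
  shows "c \<inter> c' = {}"
proof (rule ccontr)
  assume "c \<inter> c' \<noteq> {}"
  then obtain e where e: "e \<in> c" "e \<in> c'" by blast
  then obtain a b where ab: "e = {a,b}" using sg c(2) unfolding simple_graph_def by blast
  obtain d where d: "distinct [a,b,d]" "c = {{a,b},{a,d},{b,d}}" using triangle_apex c(1) e(1) ab by metis
  obtain d' where d': "distinct [a,b,d']" "c' = {{a,b},{a,d'},{b,d'}}" using triangle_apex c'(1) e(2) ab by metis
  have "cycle_edges [a,d,b,d'] \<subseteq> E" using c(2) c'(2) d d' by (auto simp: cycle_edges_def insert_commute)
  moreover have "distinct [a,d,b,d']" using d d' ne by auto
  ultimately show False using cycle_has_cycle_of_length[OF sg, of "[a,d,b,d']"] no4 by (simp add: eval_nat_numeral)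
qed

lemma triangle_edges_at:
  assumes "is_triangle c" "v \<in> \<Union> c"
  shows "card {e\<in>c. v \<in> e} = 2"
proof -
  obtain e where e: "e \<in> c" "v \<in> e" using assms(2) by blast
  obtain w where "e = {v,w}" using assms(1) e by (auto simp: is_triangle_def)
  then obtain d where d: "distinct [v,w,d]" "c = {{v,w},{v,d},{w,d}}" using triangle_apex assms(1) e(1) by metis
  have "{e\<in>c. v \<in> e} = {{v,w},{v,d}}" using d by auto
  then show ?thesis using d(1) by (simp add: doubleton_eq_iff)
qed

text \<open>Each triangle through \<open>v\<close> uses two edges at \<open>v\<close>, and different
  triangles use different ones.\<close>

lemma triangles_at_vertex:
  assumes sg: "simple_graph V E" and finV: "finite V" and no4: "\<not> has_cycle_of_length V E 4"
    and T: "\<And>c. c \<in> T \<Longrightarrow> is_triangle c \<and> c \<subseteq> E"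
  shows "2 * card {c\<in>T. v \<in> \<Union> c} \<le> card (nbrs E v)"
proof -
  have finE: "finite E" using simple_graph_finite[OF sg finV] .
  have finT: "finite T" by (rule finite_subset[of _ "Pow E"]) (use T finE in auto)
  let ?T = "{c\<in>T. v \<in> \<Union> c}"
  have "card (\<Union>c\<in>?T. {e\<in>c. v \<in> e}) = (\<Sum>c\<in>?T. card {e\<in>c. v \<in> e})"
  proof (rule card_UN_disjoint)
    show "\<forall>c\<in>?T. finite {e\<in>c. v \<in> e}" using T finE by (auto intro: finite_subset)
    show "\<forall>c\<in>?T. \<forall>c'\<in>?T. c \<noteq> c' \<longrightarrow> {e\<in>c. v \<in> e} \<inter> {e\<in>c'. v \<in> e} = {}"
      using triangles_edge_disjoint[OF sg no4] T by blast
  qed (use finT in simp)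
  also have "\<dots> = (\<Sum>c\<in>?T. 2)" using T by (intro sum.cong triangle_edges_at) auto
  finally have "2 * card ?T = card (\<Union>c\<in>?T. {e\<in>c. v \<in> e})" by simp
  also have "\<dots> \<le> card {e\<in>E. v \<in> e}" using T finE by (intro card_mono) auto
  finally show ?thesis by (simp add: card_incident[OF sg])
qed

lemma potential_lower_bound:
  assumes sg: "simple_graph V E" and finV: "finite V" and deg: "\<And>v. v \<in> V \<Longrightarrow> card (nbrs E v) \<ge> 3"
    and no: "\<forall>k\<in>{4..8}. \<not> has_cycle_of_length V E k"
    and C: "finite C" "card E + 1 \<le> card C + card V"
      "\<And>c. c \<in> C \<Longrightarrow> \<exists>cs. distinct cs \<and> length cs \<ge> 3 \<and> cycle_edges cs \<subseteq> E \<and> c = cycle_edges cs"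
      "\<And>e. e \<in> E \<Longrightarrow> card {c\<in>C. e \<in> c} \<le> 2"
  shows "potential E V \<ge> 9"
proof -
  have finE: "finite E" using simple_graph_finite[OF sg finV] .
  have cyc: "c \<subseteq> E \<and> (card c = 3 \<and> is_triangle c \<or> card c \<ge> 9)" if c: "c \<in> C" for c
  proof -
    obtain cs where cs: "distinct cs" "length cs \<ge> 3" "cycle_edges cs \<subseteq> E" "c = cycle_edges cs" using C(3)[OF c] by blast
    then have "has_cycle_of_length V E (length cs)" by (intro cycle_has_cycle_of_length[OF sg]) auto
    then have "length cs \<notin> {4..8}" using no by blast
    then have "length cs = 3 \<or> length cs \<ge> 9" using cs(2) by auto
    then show ?thesis using cs(3) triangle_cycle[OF cs(1)] unfolding cs(4) card_cycle_edges[OF cs(1,2)] by auto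
  qed
  define T where "T = {c\<in>C. card c = 3}"
  have finT: "finite T" using C(1) by (simp add: T_def)
  have T: "is_triangle c \<and> c \<subseteq> E" if "c \<in> T" for c using cyc[of c] that by (auto simp: T_def)
  have "3 * card T + 9 * card (C - T) = (\<Sum>c\<in>T. 3) + (\<Sum>c\<in>C-T. 9)" by simp
  also have "\<dots> \<le> (\<Sum>c\<in>T. card c) + (\<Sum>c\<in>C-T. card c)"
    by (intro add_mono sum_mono) (use cyc in \<open>auto simp: T_def\<close>)
  also have "\<dots> = (\<Sum>c\<in>C. card c)" using C(1) sum.subset_diff[of T C card] by (simp add: T_def)
  also have "\<dots> = (\<Sum>c\<in>C. card {e\<in>E. e \<in> c})"
  proof (rule sum.cong)
    fix c assume "c \<in> C"
    then have "{e\<in>E. e \<in> c} = c" using cyc by blast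
    then show "card c = card {e\<in>E. e \<in> c}" by simp
  qed simp
  also have "\<dots> = (\<Sum>e\<in>E. card {c\<in>C. e \<in> c})" by (rule sum_multicount_gen) (use C(1) finE in auto)
  also have "\<dots> \<le> (\<Sum>e\<in>E. 2)" by (intro sum_mono C(4))
  finally have 1: "3 * card T + 9 * card (C - T) \<le> 2 * card E" by simp
  have 2: "card C = card T + card (C - T)"
    using C(1) card_Diff_subset[OF finT, of C] card_mono[OF C(1), of T] by (auto simp: T_def)
  have no4: "\<not> has_cycle_of_length V E 4" using no by simp
  have "(\<Sum>v\<in>V. card {c\<in>T. v \<in> \<Union> c}) = (\<Sum>c\<in>T. 3)"
  proof (rule sum_multicount_gen)
    show "\<forall>c\<in>T. card {v\<in>V. v \<in> \<Union> c} = 3"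
    proof
      fix c assume c: "c \<in> T"
      then obtain x y z where xyz: "distinct [x,y,z]" "c = {{x,y},{y,z},{z,x}}" using T[OF c] by (auto simp: is_triangle_def)
      then have "{v\<in>V. v \<in> \<Union> c} = {x,y,z}" using T[OF c] sg by (fastforce simp: simple_graph_iff)
      then show "card {v\<in>V. v \<in> \<Union> c} = 3" using xyz(1) by simp
    qed
  qed (use finV finT in auto)
  then have "3 * card T + 2 * card V = (\<Sum>v\<in>V. card {c\<in>T. v \<in> \<Union> c} + 2)"
    unfolding sum.distrib by simp
  also have "\<dots> \<le> (\<Sum>v\<in>V. card (nbrs E v))"
  proof (rule sum_mono)
    fix v assume "v \<in> V"
    \<comment> \<open>For integers, 2t <= d and d >= 3 imply t + 2 <= d; at d = 3 this rests on t
      being at most 1.\<close>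
    have "2 * card {c\<in>T. v \<in> \<Union> c} \<le> card (nbrs E v)" by (rule triangles_at_vertex[OF sg finV no4 T])
    then show "card {c\<in>T. v \<in> \<Union> c} + 2 \<le> card (nbrs E v)" using deg[OF \<open>v \<in> V\<close>] by linarith
  qed
  also have "\<dots> = 2 * card E" by (rule handshake[OF sg finV])
  finally have "3 * card T + 2 * card V \<le> 2 * card E" .
  \<comment> \<open>Nine times Euler's inequality, with 9|C| <= 2|E| + 6|T| from \<open>1\<close>
    and \<open>2\<close>, and 6|T| + 4|V| <= 4|E| from the vertex count.\<close>
  then have "3 * card E + 9 \<le> 5 * card V" using 1 2 C(2) by linarith
  then show ?thesis by (simp add: potential_def edges_in_self[OF sg])
qed

theorem theorem6:
  fixes V :: "'a set" and E :: "'a set set"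
  assumes "finite V"
    and "simple_graph V E"
    and "planar V E"
    and "\<forall>k\<in>{4..8}. \<not> has_cycle_of_length V E k"
  shows "proper_3_colorable V E"
proof (rule ccontr)
  assume "\<not> proper_3_colorable V E"
  then obtain W F where W: "W \<subseteq> V" "F \<subseteq> edges_in E W" "critical W F"
    using exists_critical[OF assms(1,2)] by blast
  have finW: "finite W" and sg: "simple_graph W F" and ncW: "\<not> proper_3_colorable W F"
    using W(3) by (auto simp: critical_def)
  have FE: "F \<subseteq> E" and FW: "\<And>e. e \<in> F \<Longrightarrow> e \<subseteq> W" using W(2) by (auto simp: edges_in_def)
  have deg: "card (nbrs F v) \<ge> 3" if "v \<in> W" for v using critical_min_degree[OF W(3) that] .
  obtain p :: "'a \<Rightarrow> complex" and \<gamma> where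
    inj: "inj_on p V" and
    arcs: "\<forall>e\<in>E. arc (\<gamma> e) \<and> {pathstart (\<gamma> e), pathfinish (\<gamma> e)} = p ` e \<and>
      path_image (\<gamma> e) \<inter> p ` V = p ` e" and
    cross: "\<forall>e\<in>E. \<forall>e'\<in>E. e \<noteq> e' \<longrightarrow> path_image (\<gamma> e) \<inter> path_image (\<gamma> e') \<subseteq> p ` (e \<inter> e')"
    using assms(3) unfolding planar_def by blast
  \<comment> \<open>The drawing of the whole graph restricts to the critical subgraph, and
    criticality makes that subgraph 2-connected.\<close>
  interpret plane_2connected W F p \<gamma>
  proof
    show "inj_on p W" using inj W(1) inj_on_subset by blast
    show "path_image (\<gamma> e) \<inter> p ` W = p ` e" if "e \<in> F" for e
    proof -
      have "path_image (\<gamma> e) \<inter> p ` V = p ` e" using arcs FE that by blast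
      then show ?thesis using FW[OF that] W(1) by blast
    qed
    show "W \<noteq> {}" using ncW by (auto simp: proper_3_colorable_def)
    show "\<exists>w. w \<noteq> u \<and> {v, w} \<in> F" if "v \<in> W" for v u
    proof (rule ccontr)
      assume "\<not> ?thesis"
      then have "nbrs F v \<subseteq> {u}" by (auto simp: nbrs_def)
      then have "card (nbrs F v) \<le> 1" using card_mono[of "{u}"] by fastforce
      then show False using deg[OF that] by simp
    qed
    show "\<exists>e\<in>F. \<not> e \<subseteq> A \<and> \<not> e \<subseteq> B" if "A \<union> B = W" "A \<noteq> W" "B \<noteq> W" "card (A \<inter> B) \<le> 1" for A B
      by (rule critical_no_separation[OF W(3) that])
    show "arc (\<gamma> e)" "{pathstart (\<gamma> e), pathfinish (\<gamma> e)} = p ` e" if "e \<in> F" for e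
      using bspec[OF arcs subsetD[OF FE that]] by simp_all
    show "path_image (\<gamma> e) \<inter> path_image (\<gamma> e') \<subseteq> p ` (e \<inter> e')"
      if "e \<in> F" "e' \<in> F" "e \<noteq> e'" for e e'
      using cross subsetD[OF FE that(1)] subsetD[OF FE that(2)] that(3) by simp
  qed (rule finW, rule sg)
  obtain C where C: "finite C" "card F + 1 \<le> card C + card W"
    "\<And>c. c \<in> C \<Longrightarrow> \<exists>cs. is_cycle cs \<and> c = cycle_edges cs"
    "\<And>e. e \<in> F \<Longrightarrow> card {c\<in>C. e \<in> c} \<le> 2"
    using bounded_face_cycles by blast
  have no: "\<forall>k\<in>{4..8}. \<not> has_cycle_of_length W F k"
    using has_cycle_of_length_mono[OF _ W(1) FE] assms(4) by blast
  have cyc: "\<exists>cs. distinct cs \<and> length cs \<ge> 3 \<and> cycle_edges cs \<subseteq> F \<and> c = cycle_edges cs" if "c \<in> C" for c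
    using C(3)[OF that] unfolding is_cycle_def by blast
  have "potential F W \<ge> 9" by (rule potential_lower_bound[OF sg finW deg no C(1,2) cyc C(4)])
  then show False using critical_potential[OF W(3)] by simp
qed

end
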